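(* Let $X,Y$ be Banach spaces, $T\in\mathcal{L}(X,Y)$ and $1\leq p<\infty$. The following are equivalent: (1) $T$ is unconditionally $p$-converging; (2) $T$ maps relatively weakly $p$-precompact subsets of $X$ to relatively norm compact subsets of $Y$; (3) $T$ maps conditionally weakly $p$-compact subsets of $X$ to relatively norm compact subsets of $Y$; (4) $T$ maps relatively weakly $p$-compact subsets of $X$ to relatively norm compact subsets of $Y$.
   Context: Banach spaces are real or complex; an operator is a continuous linear map; $\mathcal{L}(X,Y)$ is the space of operators from $X$ to $Y$; $B_Z$ is the closed unit ball of $Z$; $p^{*}$ is the conjugate exponent of $p$. For $1\leq p<\infty$, a sequence $(x_n)_n$ in $X$ is weakly $p$-summable, written $(x_n)_n\in l_p^w(X)$, if $\sup\{(\sum_{n=1}^{\infty}|\langle x^*,x_n\rangle|^p)^{1/p}:x^*\in B_{X^*}\}<\infty$; it is unconditionally $p$-summable, written $(x_n)_n\in l_p^u(X)$, if moreover $\sup\{(\sum_{n=m}^{\infty}|\langle x^*,x_n\rangle|^p)^{1/p}:x^*\in B_{X^*}\}\to 0$ as $m\to\infty$. An operator $T:X\to Y$ is unconditionally $p$-converging if $(Tx_n)_n\in l_p^u(Y)$ for every $(x_n)_n\in l_p^w(X)$. A sequence $(x_n)_n$ is weakly $p$-convergent if $(x_n-x)_n$ is weakly $p$-summable for some $x\in X$; it is weakly $p$-Cauchy if for each pair of strictly increasing sequences $(k_n)_n$, $(j_n)_n$ of positive integers, $(x_{k_n}-x_{j_n})_n$ is weakly $p$-summable. A subset $K\subset X$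 is: relatively weakly $p$-compact if $K\subset S(B_{l_{p^*}})$ for some operator $S:l_{p^*}\to X$ (when $p=1$: $K\subset S(B_{c_0})$ for some operator $S:c_0\to X$); relatively weakly $p$-precompact if every sequence in $K$ has a weakly $p$-convergent subsequence; conditionally weakly $p$-compact if every sequence in $K$ has a weakly $p$-Cauchy subsequence. *)

theory Defs
  imports "HOL-Analysis.Analysis"
begin

text \<open>
  Banach spaces are real or complex. The class below contains exactly the fields that are
  isometrically isomorphic to the reals or to the complex numbers (in the first case
  the map \<open>r \<mapsto> r *\<^sub>R 1\<close> is automatically an isometric field embedding).
\<close>

class real_or_complex = real_normed_field +
  assumes real_or_complex:
    "surj (\<lambda>r. r *\<^sub>R (1 :: 'a)) \<or>
     (\<exists>\<phi> :: complex \<Rightarrow> 'a. bij \<phi> \<and> (\<forall>r. \<phi> (complex_of_real r) = r *\<^sub>R 1) \<and>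
        (\<forall>z w. \<phi> (z + w) = \<phi> z + \<phi> w) \<and> (\<forall>z w. \<phi> (z * w) = \<phi> z * \<phi> w) \<and>
        (\<forall>z. norm (\<phi> z) = norm z))"

instance real :: real_or_complex
  by standard (simp add: surj_def)

instance complex :: real_or_complex
  by standard (rule disjI2, rule exI[of _ "\<lambda>z. z"], simp add: bij_def scaleR_conv_of_real)

text \<open>
  A Banach space over \<open>'k\<close>: completeness and the norm come from the type class, the
  scalar multiplication is a parameter.
\<close>

locale banach_over = vector_space scale
  for scale :: "'k::real_or_complex \<Rightarrow> 'a::banach \<Rightarrow> 'a" +
  assumes scale_of_real: "scale (of_real r) x = r *\<^sub>R x"
    and norm_scale: "norm (scale c x) = norm c * norm x"

lemma banach_over_real: "banach_over (scaleR :: real \<Rightarrow> 'a::banach \<Rightarrow> 'a)"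
  by unfold_locales (auto simp: algebra_simps)

lemma banach_over_complex: "banach_over ((*) :: complex \<Rightarrow> complex \<Rightarrow> complex)"
  by unfold_locales (auto simp: algebra_simps norm_mult scaleR_conv_of_real)

definition operator ::
    "('k::real_or_complex \<Rightarrow> 'a::real_normed_vector \<Rightarrow> 'a) \<Rightarrow>
     ('k \<Rightarrow> 'b::real_normed_vector \<Rightarrow> 'b) \<Rightarrow> ('a \<Rightarrow> 'b) \<Rightarrow> bool" where
  "operator sX sY T \<longleftrightarrow> Vector_Spaces.linear sX sY T \<and> continuous_on UNIV T"

definition dual_ball ::
    "('k::real_or_complex \<Rightarrow> 'a::real_normed_vector \<Rightarrow> 'a) \<Rightarrow> ('a \<Rightarrow> 'k) set" where
  "dual_ball s = {f. operator s (*) f \<and> onorm f \<le> 1}"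


subsection \<open>Weakly and unconditionally \<open>p\<close>-summable sequences\<close>

text \<open>Finiteness of the supremum includes the convergence of every one of the series.\<close>

definition weakly_p_summable ::
    "('k::real_or_complex \<Rightarrow> 'a::banach \<Rightarrow> 'a) \<Rightarrow> real \<Rightarrow> (nat \<Rightarrow> 'a) \<Rightarrow> bool" where
  "weakly_p_summable s p x \<longleftrightarrow>
     (\<forall>f\<in>dual_ball s. summable (\<lambda>n. norm (f (x n)) powr p)) \<and>
     bdd_above ((\<lambda>f. (\<Sum>n. norm (f (x n)) powr p) powr (1 / p)) ` dual_ball s)"

definition unconditionally_p_summable ::
    "('k::real_or_complex \<Rightarrow> 'a::banach \<Rightarrow> 'a) \<Rightarrow> real \<Rightarrow> (nat \<Rightarrow> 'a) \<Rightarrow> bool" where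
  "unconditionally_p_summable s p x \<longleftrightarrow>
     weakly_p_summable s p x \<and>
     (\<lambda>m. SUP f\<in>dual_ball s. (\<Sum>n. norm (f (x (n + m))) powr p) powr (1 / p)) \<longlonglongrightarrow> 0"

definition unconditionally_p_converging ::
    "('k::real_or_complex \<Rightarrow> 'a::banach \<Rightarrow> 'a) \<Rightarrow> ('k \<Rightarrow> 'b::banach \<Rightarrow> 'b) \<Rightarrow>
     real \<Rightarrow> ('a \<Rightarrow> 'b) \<Rightarrow> bool" where
  "unconditionally_p_converging sX sY p T \<longleftrightarrow>
     (\<forall>x. weakly_p_summable sX p x \<longrightarrow> unconditionally_p_summable sY p (\<lambda>n. T (x n)))"

definition weakly_p_convergent ::
    "('k::real_or_complex \<Rightarrow> 'a::banach \<Rightarrow> 'a) \<Rightarrow> real \<Rightarrow> (nat \<Rightarrow> 'a) \<Rightarrow> bool" where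
  "weakly_p_convergent s p x \<longleftrightarrow> (\<exists>l. weakly_p_summable s p (\<lambda>n. x n - l))"

definition weakly_p_Cauchy ::
    "('k::real_or_complex \<Rightarrow> 'a::banach \<Rightarrow> 'a) \<Rightarrow> real \<Rightarrow> (nat \<Rightarrow> 'a) \<Rightarrow> bool" where
  "weakly_p_Cauchy s p x \<longleftrightarrow>
     (\<forall>k j. strict_mono k \<longrightarrow> strict_mono j \<longrightarrow> weakly_p_summable s p (\<lambda>n. x (k n) - x (j n)))"


subsection \<open>The sequence spaces \<open>l\<^sub>q\<close> and \<open>c\<^sub>0\<close>\<close>

text \<open>
  The sequence spaces are represented as sets of scalar sequences together with a norm function.
\<close>

definition lq :: "real \<Rightarrow> (nat \<Rightarrow> 'k::real_or_complex) set" where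
  "lq q = {a. summable (\<lambda>n. norm (a n) powr q)}"

definition lq_norm :: "real \<Rightarrow> (nat \<Rightarrow> 'k::real_or_complex) \<Rightarrow> real" where
  "lq_norm q a = (\<Sum>n. norm (a n) powr q) powr (1 / q)"

definition c0 :: "(nat \<Rightarrow> 'k::real_or_complex) set" where
  "c0 = {a. a \<longlonglongrightarrow> 0}"

definition sup_norm :: "(nat \<Rightarrow> 'k::real_or_complex) \<Rightarrow> real" where
  "sup_norm a = (SUP n. norm (a n))"

definition seq_operator ::
    "(nat \<Rightarrow> 'k::real_or_complex) set \<Rightarrow> ((nat \<Rightarrow> 'k) \<Rightarrow> real) \<Rightarrow>
     ('k \<Rightarrow> 'a::real_normed_vector \<Rightarrow> 'a) \<Rightarrow> ((nat \<Rightarrow> 'k) \<Rightarrow> 'a) \<Rightarrow> bool" where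
  "seq_operator E nrm s S \<longleftrightarrow>
     (\<forall>a\<in>E. \<forall>b\<in>E. S (\<lambda>n. a n + b n) = S a + S b) \<and>
     (\<forall>c. \<forall>a\<in>E. S (\<lambda>n. c * a n) = s c (S a)) \<and>
     (\<exists>C. \<forall>a\<in>E. norm (S a) \<le> C * nrm a)"

definition conjugate_exponent :: "real \<Rightarrow> real" where
  "conjugate_exponent p = p / (p - 1)"


subsection \<open>Weak \<open>p\<close>-compactness properties of sets\<close>

definition relatively_weakly_p_compact ::
    "('k::real_or_complex \<Rightarrow> 'a::banach \<Rightarrow> 'a) \<Rightarrow> real \<Rightarrow> 'a set \<Rightarrow> bool" where
  "relatively_weakly_p_compact s p K \<longleftrightarrow>
     (if p = 1
      then \<exists>S. seq_operator c0 sup_norm s S \<and> K \<subseteq> S ` {a \<in> c0. sup_norm a \<le> 1}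
      else let q = conjugate_exponent p in
           \<exists>S. seq_operator (lq q) (lq_norm q) s S \<and> K \<subseteq> S ` {a \<in> lq q. lq_norm q a \<le> 1})"

definition relatively_weakly_p_precompact ::
    "('k::real_or_complex \<Rightarrow> 'a::banach \<Rightarrow> 'a) \<Rightarrow> real \<Rightarrow> 'a set \<Rightarrow> bool" where
  "relatively_weakly_p_precompact s p K \<longleftrightarrow>
     (\<forall>x :: nat \<Rightarrow> 'a. range x \<subseteq> K \<longrightarrow>
        (\<exists>r. strict_mono r \<and> weakly_p_convergent s p (x \<circ> r)))"

definition conditionally_weakly_p_compact ::
    "('k::real_or_complex \<Rightarrow> 'a::banach \<Rightarrow> 'a) \<Rightarrow> real \<Rightarrow> 'a set \<Rightarrow> bool" where
  "conditionally_weakly_p_compact s p K \<longleftrightarrow>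
     (\<forall>x :: nat \<Rightarrow> 'a. range x \<subseteq> K \<longrightarrow>
        (\<exists>r. strict_mono r \<and> weakly_p_Cauchy s p (x \<circ> r)))"

definition relatively_norm_compact :: "'a::real_normed_vector set \<Rightarrow> bool" where
  "relatively_norm_compact K \<longleftrightarrow> compact (closure K)"

end

theory Submission
  imports Defs
begin

text \<open>
  All four properties are equivalent to a fifth one, which is called \<open>p_converging\<close> below:
  \<open>T\<close> sends every weakly \<open>p\<close>-summable sequence to a norm null sequence.

  It is equivalent to unconditional \<open>p\<close>-convergence. The norm of a single term \<open>T x\<^sub>m\<close> is the supremum of
  \<open>|f (T x\<^sub>m)|\<close> over the dual ball, so it is dominated by a tail of the sequence. Conversely,
  suppose that the tails of \<open>(T x\<^sub>n)\<close> do not tend to zero. Then there are consecutive blocks of indices and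
  functionals whose \<open>l\<^sub>p\<close> sum over the block exceeds some \<open>e\<close>. By the duality of \<open>l\<^sub>p\<close> with
  \<open>l\<^sub>p\<^sub>*\<close>, each such sum is the value of the functional at \<open>T w\<close> for a combination \<open>w\<close> of the \<open>x\<^sub>n\<close> in
  the block, with coefficients in the unit ball (\<open>block_combination\<close>). Disjointness of the blocks makes the
  combinations weakly \<open>p\<close>-summable, although \<open>\<parallel>T w\<parallel> > e\<close> for all of them.

  A \<open>p\<close>-converging operator turns weakly \<open>p\<close>-Cauchy sequences into norm Cauchy sequences, and a weakly
  \<open>p\<close>-convergent sequence is weakly \<open>p\<close>-Cauchy; hence conditionally weakly \<open>p\<close>-compact sets, and
  relatively weakly \<open>p\<close>-precompact ones among them, have relatively compact images. Relatively weakly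
  \<open>p\<close>-compact sets lie in the image of the ball of \<open>l\<^sub>p\<^sub>*\<close> (or \<open>c\<^sub>0\<close>) under some \<open>S\<close>. Here
  \<open>S a = \<Sum> a\<^sub>n x\<^sub>n\<close> for a weakly \<open>p\<close>-summable \<open>(x\<^sub>n)\<close>, and because \<open>(T x\<^sub>n)\<close> is unconditionally
  \<open>p\<close>-summable, the finite rank maps \<open>a \<mapsto> \<Sum>\<^bsub>n<m\<^esub> a\<^sub>n T x\<^sub>n\<close> converge to \<open>T \<circ> S\<close> uniformly on the ball, so
  that the image of the ball is totally bounded.

  For the way back, one set is enough in all three cases: the range of a weakly \<open>p\<close>-summable sequence
  is relatively weakly \<open>p\<close>-precompact and also relatively weakly \<open>p\<close>-compact, by the map
  \<open>a \<mapsto> \<Sum> a\<^sub>n x\<^sub>n\<close>. If its image is relatively norm compact, then the weakly null sequence \<open>(T x\<^sub>n)\<close> is norm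
  null.

  The estimates of norms by functionals, and the fact that a norm limit of a weakly null sequence is zero,
  rest on the Hahn-Banach theorem over the scalar field (\<open>norming_functional\<close>).
\<close>

section \<open>The Hahn-Banach theorem\<close>

definition sublinear :: "('a::real_vector \<Rightarrow> real) \<Rightarrow> bool" where
  "sublinear q \<longleftrightarrow> (\<forall>x y. q (x + y) \<le> q x + q y) \<and> (\<forall>t\<ge>0. \<forall>x. q (t *\<^sub>R x) = t * q x)"

lemma sublinearI:
  assumes "\<And>x y. q (x + y) \<le> q x + q y" and "q 0 = 0"
    and "\<And>t x. t > 0 \<Longrightarrow> q (t *\<^sub>R x) \<le> t * q x"
  shows "sublinear q"
  unfolding sublinear_def
proof (intro conjI allI impI)
  fix t :: real and x
  assume "0 \<le> t"
  show "q (t *\<^sub>R x) = t * q x"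
  proof (cases "t = 0")
    case False
    with \<open>0 \<le> t\<close> have t: "t > 0" by simp
    have "q ((1 / t) *\<^sub>R (t *\<^sub>R x)) \<le> (1 / t) * q (t *\<^sub>R x)"
      using t by (intro assms(3)) simp
    then have "t * q x \<le> q (t *\<^sub>R x)"
      using t by (simp add: field_simps)
    with assms(3)[OF t] show ?thesis
      by (intro antisym) auto
  qed (simp add: assms(2))
qed (rule assms(1))

lemma sublinear_zero: "sublinear q \<Longrightarrow> q 0 = 0"
  unfolding sublinear_def by (metis mult_zero_left order_refl scaleR_zero_left)

lemma sublinear_lower: 
  assumes "sublinear q" shows "- q (- x) \<le> q x"
proof -
  have "q (x + - x) \<le> q x + q (- x)"
    using assms unfolding sublinear_def by blast
  with sublinear_zero[OF assms] show ?thesis by simp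
qed

text \<open>
  For sublinear \<open>q\<close>, this is the largest sublinear functional below \<open>q\<close> that
  takes a value of at most \<open>- q y\<close> at \<open>- y\<close>.
\<close>
definition lowered :: "('a::real_vector \<Rightarrow> real) \<Rightarrow> 'a \<Rightarrow> 'a \<Rightarrow> real" where
  "lowered q y x = (INF t\<in>{0..}. q (x + t *\<^sub>R y) - t * q y)"

lemma lowered_le:
  assumes "sublinear q" and "t \<ge> 0"
  shows "lowered q y x \<le> q (x + t *\<^sub>R y) - t * q y"
proof -
  have "- q (- x) \<le> q (x + s *\<^sub>R y) - s * q y" if "s \<ge> 0" for s
  proof -
    have "q ((x + s *\<^sub>R y) + - x) \<le> q (x + s *\<^sub>R y) + q (- x)"
      using assms(1) unfolding sublinear_def by blast
    moreover have "q (s *\<^sub>R y) = s * q y"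
      using assms(1) that unfolding sublinear_def by blast
    ultimately show ?thesis by simp
  qed
  then have "bdd_below ((\<lambda>t. q (x + t *\<^sub>R y) - t * q y) ` {0..})"
    by (intro bdd_belowI[of _ "- q (- x)"]) auto
  then show ?thesis
    unfolding lowered_def using assms(2) by (intro cINF_lower) auto
qed

lemma lowered_greatest:
  "(\<And>t. t \<ge> 0 \<Longrightarrow> c \<le> q (x + t *\<^sub>R y) - t * q y) \<Longrightarrow> c \<le> lowered q y x"
  unfolding lowered_def by (intro cINF_greatest) auto

lemma sublinear_lowered:
  assumes q: "sublinear q"
  shows "sublinear (lowered q y)"
proof (rule sublinearI)
  have sub: "q (a + b) \<le> q a + q b" for a b
    using q unfolding sublinear_def by blast
  have hom: "q (t *\<^sub>R a) = t * q a" if "t \<ge> 0" for t a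
    using q that unfolding sublinear_def by blast
  show "lowered q y (a + b) \<le> lowered q y a + lowered q y b" for a b
  proof -
    have *: "lowered q y (a + b) \<le> (q (a + s *\<^sub>R y) - s * q y) + (q (b + t *\<^sub>R y) - t * q y)"
      if "s \<ge> 0" "t \<ge> 0" for s t
    proof -
      have "lowered q y (a + b) \<le> q ((a + b) + (s + t) *\<^sub>R y) - (s + t) * q y"
        using that by (intro lowered_le q) simp
      moreover have "q ((a + b) + (s + t) *\<^sub>R y) \<le> q (a + s *\<^sub>R y) + q (b + t *\<^sub>R y)"
        using sub[of "a + s *\<^sub>R y" "b + t *\<^sub>R y"] by (simp add: algebra_simps)
      ultimately show ?thesis by (simp add: algebra_simps)
    qed
    have "lowered q y (a + b) - (q (a + s *\<^sub>R y) - s * q y) \<le> lowered q y b" if "s \<ge> 0" for s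
    proof (rule lowered_greatest)
      fix t :: real assume "t \<ge> 0"
      from *[OF that this]
      show "lowered q y (a + b) - (q (a + s *\<^sub>R y) - s * q y) \<le> q (b + t *\<^sub>R y) - t * q y"
        by linarith
    qed
    then have "lowered q y (a + b) - lowered q y b \<le> lowered q y a"
      by (intro lowered_greatest) (smt (verit))
    then show ?thesis by simp
  qed
  have "lowered q y 0 \<le> 0"
    using lowered_le[OF q, of 0 y 0] sublinear_zero[OF q] by simp
  moreover have "0 \<le> lowered q y 0"
    by (rule lowered_greatest) (simp add: hom)
  ultimately show "lowered q y 0 = 0" by simp
  show "lowered q y (c *\<^sub>R a) \<le> c * lowered q y a" if "c > 0" for c a
  proof -
    have "lowered q y (c *\<^sub>R a) / c \<le> lowered q y a"
    proof (rule lowered_greatest)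
      fix t :: real assume t: "t \<ge> 0"
      have "lowered q y (c *\<^sub>R a) \<le> q (c *\<^sub>R a + (c * t) *\<^sub>R y) - (c * t) * q y"
        using t that by (intro lowered_le q) simp
      also have "c *\<^sub>R a + (c * t) *\<^sub>R y = c *\<^sub>R (a + t *\<^sub>R y)"
        by (simp add: algebra_simps)
      also have "q \<dots> = c * q (a + t *\<^sub>R y)"
        using that by (simp add: hom)
      finally show "lowered q y (c *\<^sub>R a) / c \<le> q (a + t *\<^sub>R y) - t * q y"
        using that by (simp add: field_simps)
    qed
    then show ?thesis using that by (simp add: field_simps)
  qed
qed

text \<open>
  The bound \<open>q0\<close> keeps the infimum finite: \<open>q x \<ge> - q (- x) \<ge> - q0 (- x)\<close> for each \<open>q\<close> in the chain. For
  subadditivity, two members of the chain are replaced by the smaller one of them.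
\<close>
lemma sublinear_Inf_chain:
  assumes ne: "C \<noteq> {}" and sub: "\<And>q. q \<in> C \<Longrightarrow> sublinear q"
    and dom: "\<And>q x. q \<in> C \<Longrightarrow> q x \<le> q0 x"
    and chain: "\<And>q r. q \<in> C \<Longrightarrow> r \<in> C \<Longrightarrow> q \<le> r \<or> r \<le> q"
  shows "sublinear (\<lambda>x. INF q\<in>C. q x) \<and> (\<forall>r\<in>C. (\<lambda>x. INF q\<in>C. q x) \<le> r)"
proof -
  have bdd: "bdd_below ((\<lambda>q. q x) ` C)" for x
  proof (rule bdd_belowI)
    fix v assume "v \<in> (\<lambda>q. q x) ` C"
    then obtain q where q: "q \<in> C" "v = q x" by blast
    with sublinear_lower[OF sub, of q x] dom[OF q(1), of "- x"] show "- q0 (- x) \<le> v" by simp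
  qed
  have low: "(INF q\<in>C. q x) \<le> q x" if "q \<in> C" for q x
    using bdd that by (rule cINF_lower)
  have "sublinear (\<lambda>x. INF q\<in>C. q x)"
  proof (rule sublinearI)
    fix x y
    have *: "(INF q\<in>C. q (x + y)) \<le> q x + r y" if qr: "q \<in> C" "r \<in> C" for q r
    proof -
      obtain m where m: "m \<in> C" "m \<le> q" "m \<le> r"
        using chain[OF qr] qr by (metis order_refl)
      have "(INF q\<in>C. q (x + y)) \<le> m (x + y)" by (rule low[OF m(1)])
      also have "\<dots> \<le> m x + m y" using sub[OF m(1)] unfolding sublinear_def by blast
      also have "\<dots> \<le> q x + r y" using m by (intro add_mono) (auto simp: le_fun_def)
      finally show ?thesis .
    qed
    have "(INF q\<in>C. q (x + y)) - q x \<le> (INF q\<in>C. q y)" if "q \<in> C" for q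
      using *[OF that] by (intro cINF_greatest ne) (simp add: algebra_simps)
    then have "(INF q\<in>C. q (x + y)) - (INF q\<in>C. q y) \<le> (INF q\<in>C. q x)"
      by (intro cINF_greatest ne) (simp add: algebra_simps)
    then show "(INF q\<in>C. q (x + y)) \<le> (INF q\<in>C. q x) + (INF q\<in>C. q y)" by simp
  next
    have "(\<lambda>q. q 0) ` C = {0}" using ne sublinear_zero[OF sub] by force
    then show "(INF q\<in>C. q 0) = 0" by simp
  next
    fix t :: real and x assume t: "t > 0"
    have "(INF q\<in>C. q (t *\<^sub>R x)) / t \<le> (INF q\<in>C. q x)"
    proof (intro cINF_greatest ne)
      fix q assume q: "q \<in> C"
      have "(INF q\<in>C. q (t *\<^sub>R x)) \<le> q (t *\<^sub>R x)" by (rule low[OF q])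
      also have "\<dots> = t * q x" using sub[OF q] t unfolding sublinear_def by simp
      finally show "(INF q\<in>C. q (t *\<^sub>R x)) / t \<le> q x" using t by (simp add: field_simps)
    qed
    then show "(INF q\<in>C. q (t *\<^sub>R x)) \<le> t * (INF q\<in>C. q x)"
      using t by (simp add: field_simps)
  qed
  with low show ?thesis by (simp add: le_fun_def)
qed

text \<open>
  A minimal sublinear functional is linear. Zorn's lemma is applied to functionals on the
  whole space, so no extension of partial functionals from subspaces occurs.
\<close>
lemma linear_below_sublinear:
  assumes q0: "sublinear q0"
  obtains f where "linear f" and "\<And>x. f x \<le> q0 x"
proof -
  define A where "A = {q. sublinear q \<and> q \<le> q0}"
  have "\<exists>m\<in>A. \<forall>a\<in>A. a \<le> m \<longrightarrow> a = m"
  proof (rule predicate_Zorn)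
    show "partial_order_on A (relation_of (\<lambda>q r. r \<le> q) A)"
      by (rule partial_order_on_relation_ofI) auto
  next
    fix C assume C: "C \<in> Chains (relation_of (\<lambda>q r. r \<le> q) A)"
    then have CA: "C \<subseteq> A" and ch: "\<And>q r. q \<in> C \<Longrightarrow> r \<in> C \<Longrightarrow> q \<le> r \<or> r \<le> q"
      unfolding Chains_def relation_of_def by blast+
    show "\<exists>u\<in>A. \<forall>a\<in>C. u \<le> a"
    proof (cases "C = {}")
      case True
      with q0 show ?thesis by (auto simp: A_def)
    next
      case False
      have sub: "\<And>q. q \<in> C \<Longrightarrow> sublinear q" and dom: "\<And>q x. q \<in> C \<Longrightarrow> q x \<le> q0 x"
        using CA by (auto simp: A_def le_fun_def)
      define u where "u = (\<lambda>x. INF q\<in>C. q x)"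
      have "sublinear u \<and> (\<forall>q\<in>C. u \<le> q)"
        unfolding u_def by (rule sublinear_Inf_chain[where ?q0.0 = q0]) (use False sub dom ch in auto)
      then have u: "sublinear u" and le: "\<And>q. q \<in> C \<Longrightarrow> u \<le> q" by auto
      obtain q where "q \<in> C" using False by blast
      then have "u \<le> q0"
        using le[of q] CA by (auto simp: A_def intro: order_trans)
      with u have "u \<in> A" by (simp add: A_def)
      with le show ?thesis by blast
    qed
  qed
  then obtain m where m: "sublinear m" "m \<le> q0" and min: "\<And>a. sublinear a \<Longrightarrow> a \<le> m \<Longrightarrow> a = m"
    unfolding A_def by (smt (verit) mem_Collect_eq order_trans)
  \<comment> \<open>Minimality forces every lowering of \<open>m\<close> to be \<open>m\<close> itself; at \<open>t = 1\<close> this says that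
    \<open>m x \<le> m (x + y) - m y\<close>, the missing half of additivity.\<close>
  have low: "lowered m y = m" for y
  proof (rule min)
    show "sublinear (lowered m y)" by (rule sublinear_lowered[OF m(1)])
    show "lowered m y \<le> m"
      using lowered_le[OF m(1), of 0 y] by (simp add: le_fun_def)
  qed
  have add: "m (x + y) = m x + m y" for x y
  proof (rule antisym)
    show "m (x + y) \<le> m x + m y" using m(1) unfolding sublinear_def by blast
    show "m x + m y \<le> m (x + y)"
      using lowered_le[OF m(1), of 1 y x] by (simp add: low)
  qed
  have neg: "m (- x) = - m x" for x
    using add[of x "- x"] sublinear_zero[OF m(1)] by simp
  have "m (t *\<^sub>R x) = t * m x" for t x
  proof (cases "t \<ge> 0")
    case True
    then show ?thesis using m(1) unfolding sublinear_def by blast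
  next
    case False
    then have "m ((- t) *\<^sub>R x) = (- t) * m x" using m(1) unfolding sublinear_def
      by (meson neg_0_le_iff_le nle_le)
    then show ?thesis using neg[of "t *\<^sub>R x"] by simp
  qed
  with add have "linear m" by (intro linearI) auto
  with m(2) that show ?thesis by (auto simp: le_fun_def)
qed

text \<open>
  Below the norm lowered in the direction of \<open>x0\<close>, a linear functional must satisfy
  \<open>f (- x0) \<le> - \<parallel>x0\<parallel>\<close>.
\<close>
lemma real_norming_functional:
  fixes x0 :: "'a::real_normed_vector"
  obtains f where "linear f" and "\<And>x. f x \<le> norm x" and "f x0 = norm x0"
proof -
  have n: "sublinear (norm :: 'a \<Rightarrow> real)"
    unfolding sublinear_def by (simp add: norm_triangle_ineq)
  obtain f where f: "linear f" and le: "\<And>x. f x \<le> lowered norm x0 x"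
    using linear_below_sublinear[OF sublinear_lowered[OF n]] by blast
  have dom: "f x \<le> norm x" for x
    using le[of x] lowered_le[OF n, of 0 x0 x] by simp
  have "f (- x0) \<le> - norm x0"
    using le[of "- x0"] lowered_le[OF n, of 1 x0 "- x0"] by simp
  then have "norm x0 \<le> f x0" using linear_neg[OF f, of x0] by simp
  with dom[of x0] have "f x0 = norm x0" by simp
  with f dom that show ?thesis by blast
qed

lemma (in banach_over) dual_ballI:
  assumes "Vector_Spaces.linear scale (*) f" and "\<And>x. norm (f x) \<le> norm x"
  shows "f \<in> dual_ball scale"
proof -
  interpret f: Vector_Spaces.linear scale "(*)" f by (rule assms(1))
  have "bounded_linear f"
  proof (rule bounded_linear_intro)
    show "f (r *\<^sub>R x) = r *\<^sub>R f x" for r x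
      using f.scale[of "of_real r" x] by (simp add: scale_of_real scaleR_conv_of_real)
    show "norm (f x) \<le> norm x * 1" for x using assms(2) by simp
  qed (simp add: f.add)
  then have "operator scale (*) f"
    unfolding operator_def using assms(1) by (simp add: linear_continuous_on)
  moreover have "onorm f \<le> 1" using assms(2) by (intro onorm_bound) auto
  ultimately show ?thesis by (simp add: dual_ball_def)
qed

text \<open>
  The complex case is the usual complexification \<open>x \<mapsto> g x - \<i> g (\<i> x)\<close> of a real functional \<open>g\<close>.
  As the scalar field is only known up to an isometric isomorphism \<open>\<phi>\<close> with the complex numbers, the
  computation is done for a complex-valued \<open>h\<close>, and \<open>f = \<phi> \<circ> h\<close>.
\<close>
lemma (in banach_over) norming_functional:
  obtains f where "f \<in> dual_ball scale" and "norm (f x0) = norm x0"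
proof -
  obtain g where g: "linear g" and gle: "\<And>x. g x \<le> norm x" and g0: "g x0 = norm x0"
    using real_norming_functional by blast
  note gadd = linear_add[OF g] and gsc = linear_scale[OF g]
  have vs: "vector_space ((*) :: 'k \<Rightarrow> 'k \<Rightarrow> 'k)"
    by unfold_locales (simp_all add: algebra_simps)
  have "\<exists>f :: 'a \<Rightarrow> 'k. Vector_Spaces.linear scale (*) f \<and> (\<forall>x. norm (f x) \<le> norm x) \<and> norm x0 \<le> norm (f x0)"
    using real_or_complex[where ?'a = 'k]
  proof (elim disjE exE conjE)
    assume surj: "surj (\<lambda>r. r *\<^sub>R (1 :: 'k))"
    define f :: "'a \<Rightarrow> 'k" where "f x = of_real (g x)" for x
    have "Vector_Spaces.linear scale (*) f"
      unfolding Vector_Spaces.linear_iff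
    proof (intro conjI allI vector_space_axioms vs)
      show "f (a + b) = f a + f b" for a b by (simp add: f_def gadd)
      fix c :: 'k and x :: 'a
      obtain r where "c = of_real r" using surjD[OF surj, of c] by (auto simp: of_real_def)
      then show "f (scale c x) = c * f x" by (simp add: f_def scale_of_real gsc)
    qed
    moreover have "norm (f x) \<le> norm x" for x
      using gle[of x] gle[of "- x"] linear_neg[OF g, of x] by (simp add: f_def abs_le_iff)
    ultimately show ?thesis using g0 by (intro exI[of _ f]) (simp add: f_def)
  next
    fix \<phi> :: "complex \<Rightarrow> 'k"
    assume bij: "bij \<phi>" and re: "\<forall>r. \<phi> (complex_of_real r) = r *\<^sub>R 1"
      and add: "\<forall>z w. \<phi> (z + w) = \<phi> z + \<phi> w" and mult: "\<forall>z w. \<phi> (z * w) = \<phi> z * \<phi> w"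
      and nrm: "\<forall>z. norm (\<phi> z) = norm z"
    define h where "h x = Complex (g x) (- g (scale (\<phi> \<i>) x))" for x
    define f where "f x = \<phi> (h x)" for x
    have ii: "scale (\<phi> \<i>) (scale (\<phi> \<i>) x) = - x" for x
    proof -
      have "\<phi> \<i> * \<phi> \<i> = of_real (- 1)"
        using mult re by (metis complex_i_mult_minus i_squared mult_minus1_right of_real_def of_real_1 of_real_minus)
      then have "scale (\<phi> \<i>) (scale (\<phi> \<i>) x) = scale (of_real (- 1)) x" by simp
      also have "\<dots> = - x" by (subst scale_of_real) simp
      finally show ?thesis .
    qed
    have hadd: "h (x + y) = h x + h y" for x y
      by (simp add: h_def gadd scale_right_distrib complex_eq_iff)
    have hre: "h (scale (\<phi> (complex_of_real r)) x) = complex_of_real r * h x" for r x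
    proof -
      have "scale (\<phi> (complex_of_real r)) y = r *\<^sub>R y" for y
        using re scale_of_real[of r y] by (simp add: of_real_def)
      moreover have "scale (\<phi> \<i>) (scale (\<phi> (complex_of_real r)) x)
          = scale (\<phi> (complex_of_real r)) (scale (\<phi> \<i>) x)"
        by (simp add: mult.commute)
      ultimately show ?thesis by (simp add: h_def gsc complex_eq_iff del: scale_scale)
    qed
    have him: "h (scale (\<phi> \<i>) x) = \<i> * h x" for x
      using linear_neg[OF g, of x] by (simp add: h_def ii complex_eq_iff del: scale_scale)
    have hsc: "h (scale (\<phi> z) x) = z * h x" for z x
    proof -
      have "\<phi> z = \<phi> (complex_of_real (Re z)) + \<phi> \<i> * \<phi> (complex_of_real (Im z))"
        using add mult by (metis complex_eq)
      then have "scale (\<phi> z) x = scale (\<phi> (complex_of_real (Re z))) x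
          + scale (\<phi> \<i>) (scale (\<phi> (complex_of_real (Im z))) x)"
        by (simp add: scale_left_distrib)
      then have "h (scale (\<phi> z) x) = (Re z + \<i> * Im z) * h x"
        by (simp add: hadd hre him algebra_simps del: scale_scale)
      then show ?thesis by (metis complex_eq)
    qed
    have "Vector_Spaces.linear scale (*) f"
      unfolding Vector_Spaces.linear_iff
    proof (intro conjI allI vector_space_axioms vs)
      show "f (a + b) = f a + f b" for a b by (simp add: f_def hadd add)
      fix c :: 'k and x :: 'a
      obtain z where "c = \<phi> z" using bij by (metis bij_pointE)
      then show "f (scale c x) = c * f x" by (simp add: f_def hsc mult)
    qed
    moreover have "norm (f x) \<le> norm x" for x
    proof (cases "h x = 0")
      case True then show ?thesis using nrm by (simp add: f_def)
    next
      case False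
      \<comment> \<open>Rotating \<open>x\<close> by \<open>c\<close> makes the value of \<open>h\<close> real, where it agrees with \<open>g\<close>.\<close>
      define c where "c = cnj (h x) / norm (h x)"
      have c: "norm c = 1" using False by (simp add: c_def norm_divide)
      have "c * h x = complex_of_real (norm (h x))"
        using False by (simp add: c_def complex_norm_square[symmetric] mult.commute power2_eq_square)
      then have "h (scale (\<phi> c) x) = complex_of_real (norm (h x))" by (simp add: hsc)
      then have "norm (h x) = g (scale (\<phi> c) x)"
        by (simp add: h_def complex_eq_iff)
      also have "\<dots> \<le> norm (scale (\<phi> c) x)" by (rule gle)
      also have "\<dots> = norm x" using nrm c by (simp add: norm_scale)
      finally show ?thesis using nrm by (simp add: f_def)
    qed
    moreover have "norm x0 \<le> norm (f x0)"
    proof -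
      have "norm x0 = Re (h x0)" by (simp add: h_def g0)
      also have "\<dots> \<le> norm (h x0)" by (rule complex_Re_le_cmod)
      finally show ?thesis using nrm by (simp add: f_def)
    qed
    ultimately show ?thesis by blast
  qed
  then obtain f :: "'a \<Rightarrow> 'k" where f: "Vector_Spaces.linear scale (*) f" "\<And>x. norm (f x) \<le> norm x"
      "norm x0 \<le> norm (f x0)" by blast
  then have "f \<in> dual_ball scale" by (intro dual_ballI) auto
  with f(2)[of x0] f(3) that show ?thesis by fastforce
qed

section \<open>Duality of sequence spaces\<close>

lemma Holder_inequality_finite:
  fixes a u :: "'i \<Rightarrow> real"
  assumes p: "p > 1" and A: "finite A"
    and a: "\<And>i. i \<in> A \<Longrightarrow> 0 \<le> a i" and u: "\<And>i. i \<in> A \<Longrightarrow> 0 \<le> u i"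
  defines "q \<equiv> conjugate_exponent p"
  shows "(\<Sum>i\<in>A. a i * u i) \<le> (\<Sum>i\<in>A. a i powr q) powr (1 / q) * (\<Sum>i\<in>A. u i powr p) powr (1 / p)"
proof -
  define \<alpha> where "\<alpha> = (\<Sum>i\<in>A. a i powr q) powr (1 / q)"
  define \<beta> where "\<beta> = (\<Sum>i\<in>A. u i powr p) powr (1 / p)"
  have q: "q > 1" "1 / q + 1 / p = 1"
    using p by (auto simp: q_def conjugate_exponent_def field_simps)
  have "\<alpha> \<ge> 0" "\<beta> \<ge> 0" by (simp_all add: \<alpha>_def \<beta>_def)
  have aq: "(\<Sum>i\<in>A. a i powr q) = \<alpha> powr q"
    using q by (simp add: \<alpha>_def powr_powr sum_nonneg)
  have up: "(\<Sum>i\<in>A. u i powr p) = \<beta> powr p"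
    using p by (simp add: \<beta>_def powr_powr sum_nonneg)
  have zero: "(\<Sum>i\<in>A. a i * u i) = 0" if "\<alpha> = 0 \<or> \<beta> = 0"
  proof -
    have "a i = 0 \<or> u i = 0" if "i \<in> A" for i
      using \<open>\<alpha> = 0 \<or> \<beta> = 0\<close> aq up that A by (auto simp: sum_nonneg_eq_0_iff)
    then show ?thesis by (intro sum.neutral) auto
  qed
  show ?thesis
  proof (cases "\<alpha> = 0 \<or> \<beta> = 0")
    case True
    with zero show ?thesis by (auto simp: \<alpha>_def \<beta>_def)
  next
    case False
    with \<open>\<alpha> \<ge> 0\<close> \<open>\<beta> \<ge> 0\<close> have pos: "\<alpha> > 0" "\<beta> > 0" by auto
    have "(\<Sum>i\<in>A. (a i / \<alpha>) * (u i / \<beta>)) \<le> (\<Sum>i\<in>A. (a i / \<alpha>) powr q / q + (u i / \<beta>) powr p / p)"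
      using a u pos p q by (intro sum_mono Youngs_inequality) auto
    also have "\<dots> = (\<Sum>i\<in>A. a i powr q) / \<alpha> powr q / q + (\<Sum>i\<in>A. u i powr p) / \<beta> powr p / p"
      using a u pos by (simp add: sum.distrib sum_divide_distrib powr_divide)
    also have "\<dots> = 1"
      using pos q(2) by (simp add: aq up)
    finally have "(\<Sum>i\<in>A. a i * u i) / (\<alpha> * \<beta>) \<le> 1"
      by (simp add: sum_divide_distrib)
    then show ?thesis
      using pos by (simp add: \<alpha>_def[symmetric] \<beta>_def[symmetric] field_simps)
  qed
qed

text \<open>
  Let \<open>conj_space p\<close> be \<open>l\<^sub>q\<close> for the conjugate exponent \<open>q\<close> of \<open>p\<close>, and \<open>c\<^sub>0\<close> (not \<open>l\<^sub>\<infinity>\<close>) when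
  \<open>p = 1\<close>. In both cases the tails of each element tend to zero in norm, so that finitely supported
  sequences are dense; this fails in \<open>l\<^sub>\<infinity>\<close>, and it is why \<open>\<Sum> a\<^sub>n x\<^sub>n\<close> converges below.
\<close>
definition conj_space :: "real \<Rightarrow> (nat \<Rightarrow> 'k::real_or_complex) set" where
  "conj_space p = (if p = 1 then c0 else lq (conjugate_exponent p))"

definition conj_norm :: "real \<Rightarrow> (nat \<Rightarrow> 'k::real_or_complex) \<Rightarrow> real" where
  "conj_norm p a = (if p = 1 then sup_norm a else lq_norm (conjugate_exponent p) a)"

definition seq_restrict :: "nat set \<Rightarrow> (nat \<Rightarrow> 'k::zero) \<Rightarrow> nat \<Rightarrow> 'k" where
  "seq_restrict A a = (\<lambda>n. if n \<in> A then a n else 0)"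

lemma norm_le_sup_norm:
  assumes "a \<in> c0"
  shows "norm (a n) \<le> sup_norm a"
proof -
  have "bounded (range a)"
    using assms by (auto simp: c0_def intro: convergent_imp_bounded)
  then have "bdd_above (range (\<lambda>n. norm (a n)))"
    using bdd_above_norm[of "range a"] by (simp add: image_image)
  then show ?thesis unfolding sup_norm_def by (intro cSUP_upper) auto
qed

lemma conj_norm_pairing:
  assumes p: "p \<ge> 1" and a: "a \<in> conj_space p" and A: "finite A"
    and u: "\<And>i. i \<in> A \<Longrightarrow> 0 \<le> u i"
  shows "(\<Sum>i\<in>A. norm (a i) * u i) \<le> conj_norm p a * (\<Sum>i\<in>A. u i powr p) powr (1 / p)"
proof (cases "p = 1")
  case True
  with a have "a \<in> c0" by (simp add: conj_space_def)
  then have "(\<Sum>i\<in>A. norm (a i) * u i) \<le> (\<Sum>i\<in>A. sup_norm a * u i)"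
    using u by (intro sum_mono mult_right_mono norm_le_sup_norm)
  also have "\<dots> = sup_norm a * (\<Sum>i\<in>A. u i)" by (simp add: sum_distrib_left)
  also have "(\<Sum>i\<in>A. u i) = (\<Sum>i\<in>A. u i powr p) powr (1 / p)"
    using u True by (simp add: sum_nonneg)
  finally show ?thesis using True by (simp add: conj_norm_def)
next
  case False
  define q where "q = conjugate_exponent p"
  have "p > 1" using p False by simp
  then have "q > 1" by (simp add: q_def conjugate_exponent_def field_simps)
  have sm: "summable (\<lambda>n. norm (a n) powr q)"
    using a False by (simp add: conj_space_def lq_def q_def)
  have "(\<Sum>i\<in>A. norm (a i) * u i)
      \<le> (\<Sum>i\<in>A. norm (a i) powr q) powr (1 / q) * (\<Sum>i\<in>A. u i powr p) powr (1 / p)"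
    unfolding q_def using \<open>p > 1\<close> A u by (intro Holder_inequality_finite) auto
  also have "\<dots> \<le> (\<Sum>i. norm (a i) powr q) powr (1 / q) * (\<Sum>i\<in>A. u i powr p) powr (1 / p)"
    using \<open>q > 1\<close> sm A
    by (intro mult_right_mono powr_mono2 sum_le_suminf sum_nonneg) auto
  finally show ?thesis using False by (simp add: conj_norm_def lq_norm_def q_def)
qed

lemma norm_le_conj_norm:
  assumes "p \<ge> 1" and "a \<in> conj_space p"
  shows "norm (a n) \<le> conj_norm p a"
  using conj_norm_pairing[OF assms, of "{n}" "\<lambda>_. 1"] by simp

lemma conj_norm_nonneg: "p \<ge> 1 \<Longrightarrow> a \<in> conj_space p \<Longrightarrow> 0 \<le> conj_norm p a"
  using norm_le_conj_norm[of p a 0] norm_ge_zero order_trans by blast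

lemma seq_restrict_finite_mem_conj_space: "finite A \<Longrightarrow> seq_restrict A a \<in> conj_space p"
proof -
  assume A: "finite A"
  then obtain N where N: "\<And>n. n \<in> A \<Longrightarrow> n < N"
    using finite_nat_set_iff_bounded by auto
  have "eventually (\<lambda>n. seq_restrict A a n = 0) sequentially"
    using N unfolding eventually_sequentially seq_restrict_def by (metis leD)
  then have "seq_restrict A a \<in> c0"
    unfolding c0_def by (simp add: tendsto_eventually)
  moreover have "seq_restrict A a \<in> lq r" for r
    unfolding lq_def mem_Collect_eq by (rule summable_finite[OF A]) (simp add: seq_restrict_def)
  ultimately show ?thesis by (simp add: conj_space_def)
qed

lemma seq_restrict_mem_conj_space:
  assumes "a \<in> conj_space p"
  shows "seq_restrict A a \<in> conj_space p"
proof (cases "p = 1")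
  case True
  have "a \<longlonglongrightarrow> 0" using assms True by (simp add: conj_space_def c0_def)
  then have "(\<lambda>n. norm (a n)) \<longlonglongrightarrow> 0" by (rule tendsto_norm_zero)
  then have "seq_restrict A a \<longlonglongrightarrow> 0"
    by (rule Lim_null_comparison[rotated]) (simp add: seq_restrict_def)
  then show ?thesis using True by (simp add: conj_space_def c0_def)
next
  case False
  then have "summable (\<lambda>n. norm (a n) powr conjugate_exponent p)"
    using assms by (simp add: conj_space_def lq_def)
  then have "summable (\<lambda>n. norm (seq_restrict A a n) powr conjugate_exponent p)"
    by (rule summable_comparison_test_ev[rotated]) (simp add: seq_restrict_def)
  then show ?thesis using False by (simp add: conj_space_def lq_def)
qed

lemma conj_norm_tail_tendsto_0:
  assumes p: "p \<ge> 1" and a: "a \<in> conj_space p"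
  shows "(\<lambda>m. conj_norm p (seq_restrict {m..} a)) \<longlonglongrightarrow> 0"
proof (cases "p = 1")
  case True
  then have a0: "a \<longlonglongrightarrow> 0" using a by (simp add: conj_space_def c0_def)
  show ?thesis
  proof (rule LIMSEQ_I)
    fix e :: real assume "e > 0"
    then obtain N where N: "\<And>n. n \<ge> N \<Longrightarrow> norm (a n) < e / 2"
      using LIMSEQ_D[OF a0, of "e / 2"] by auto
    have "norm (conj_norm p (seq_restrict {m..} a) - 0) < e" if "m \<ge> N" for m
    proof -
      have "norm (seq_restrict {m..} a n) \<le> e / 2" for n
        using N[of n] \<open>e > 0\<close> that by (auto simp: seq_restrict_def)
      then have "conj_norm p (seq_restrict {m..} a) \<le> e / 2"
        unfolding conj_norm_def sup_norm_def if_P[OF True] by (intro cSUP_least) auto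
      with conj_norm_nonneg[OF p seq_restrict_mem_conj_space[OF a], of "{m..}"] \<open>e > 0\<close> show ?thesis by simp
    qed
    then show "\<exists>N. \<forall>m\<ge>N. norm (conj_norm p (seq_restrict {m..} a) - 0) < e" by blast
  qed
next
  case False
  define q where "q = conjugate_exponent p"
  have "p > 1" using p False by simp
  then have "q > 1" by (simp add: q_def conjugate_exponent_def field_simps)
  have sm: "summable (\<lambda>n. norm (a n) powr q)"
    using a False by (simp add: conj_space_def lq_def q_def)
  have eq: "(\<Sum>n. norm (seq_restrict {m..} a n) powr q) = (\<Sum>n. norm (a (n + m)) powr q)" for m
  proof -
    have "summable (\<lambda>n. norm (seq_restrict {m..} a n) powr q)"
      using seq_restrict_mem_conj_space[OF a] False by (simp add: conj_space_def lq_def q_def)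
    from suminf_split_initial_segment[OF this, of m] show ?thesis
      by (simp add: seq_restrict_def)
  qed
  have "(\<lambda>m. \<Sum>n. norm (a (n + m)) powr q) \<longlonglongrightarrow> 0"
    using suminf_exist_split2[OF sm] by simp
  then have "(\<lambda>m. (\<Sum>n. norm (a (n + m)) powr q) powr (1 / q)) \<longlonglongrightarrow> 0"
    using \<open>q > 1\<close> summable_ignore_initial_segment[OF sm]
    by (intro tendsto_zero_powrI[where b = "1 / q"] tendsto_const) (auto intro!: suminf_nonneg always_eventually)
  then show ?thesis
    using False by (simp add: conj_norm_def lq_norm_def eq flip: q_def)
qed

text \<open>
  The inequality of Hoelder is sharp on finite sets. The extremal coefficients are
  \<open>a\<^sub>n = (|z\<^sub>n| / z\<^sub>n) |z\<^sub>n|\<^bsup>p-1\<^esup> / C\<^bsup>(p-1)/p\<^esup>\<close> with \<open>C = \<Sum> |z\<^sub>n|\<^sup>p\<close>; the one formula also serves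
  \<open>p = 1\<close>, and all \<open>z\<^sub>n = 0\<close> where division by zero yields the zero sequence.
\<close>
lemma conj_norm_attained:
  fixes z :: "nat \<Rightarrow> 'k::real_or_complex"
  assumes p: "p \<ge> 1" and A: "finite A"
  obtains a where "seq_restrict A a \<in> conj_space p" "conj_norm p (seq_restrict A a) \<le> 1"
    "(\<Sum>n\<in>A. a n * z n) = of_real ((\<Sum>n\<in>A. norm (z n) powr p) powr (1 / p))"
proof -
  define C where "C = (\<Sum>n\<in>A. norm (z n) powr p)"
  define D where "D = C powr ((p - 1) / p)"
  define a where "a n = of_real (norm (z n) powr (p - 1) / D) * (of_real (norm (z n)) / z n)" for n
  have zpow: "norm (z n) powr (p - 1) * norm (z n) = norm (z n) powr p" for n
    by (simp add: powr_diff)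
  have zA: "z n = 0" if "C = 0" "n \<in> A" for n
    using that A by (auto simp: C_def sum_nonneg_eq_0_iff)
  have "C \<ge> 0" by (simp add: C_def sum_nonneg)
  have norma: "norm (a n) = norm (z n) powr (p - 1) / D" if "z n \<noteq> 0" for n
    using that by (simp add: a_def norm_mult norm_divide D_def)
  have "(\<Sum>n\<in>A. a n * z n) = (\<Sum>n\<in>A. of_real (norm (z n) powr p / D))"
  proof (rule sum.cong[OF refl])
    fix n
    show "a n * z n = of_real (norm (z n) powr p / D)"
      by (cases "z n = 0") (simp_all add: a_def flip: zpow)
  qed
  also have "\<dots> = of_real (C / D)"
    by (simp add: C_def sum_divide_distrib)
  also have "C / D = C powr (1 / p)"
  proof (cases "C = 0")
    case False
    then have "C / D = C powr (1 - (p - 1) / p)"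
      using \<open>C \<ge> 0\<close> by (simp add: D_def powr_diff)
    also have "1 - (p - 1) / p = 1 / p" using p by (simp add: field_simps)
    finally show ?thesis .
  qed (use p in simp)
  finally have "(\<Sum>n\<in>A. a n * z n) = of_real (C powr (1 / p))" .
  moreover have "conj_norm p (seq_restrict A a) \<le> 1"
  proof (cases "p = 1")
    case True
    have "norm (seq_restrict A a n) \<le> 1" for n
    proof (cases "n \<in> A \<and> z n \<noteq> 0")
      case True
      then have "C > 0" using zA[of n] \<open>C \<ge> 0\<close> by force
      then show ?thesis using True norma[of n] \<open>p = 1\<close> by (simp add: seq_restrict_def D_def)
    qed (auto simp: seq_restrict_def a_def)
    then show ?thesis using True by (simp add: conj_norm_def sup_norm_def cSUP_least)
  next
    case False
    define q where "q = conjugate_exponent p"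
    have "p > 1" using p False by simp
    then have "q > 1" and q: "(p - 1) * q = p" "(p - 1) / p * q = 1"
      by (auto simp: q_def conjugate_exponent_def field_simps)
    have "(\<Sum>n. norm (seq_restrict A a n) powr q) = (\<Sum>n\<in>A. norm (seq_restrict A a n) powr q)"
      by (rule suminf_finite[OF A]) (simp add: seq_restrict_def)
    also have "\<dots> = (\<Sum>n\<in>A. norm (z n) powr p / C)"
    proof (rule sum.cong[OF refl])
      fix n assume n: "n \<in> A"
      show "norm (seq_restrict A a n) powr q = norm (z n) powr p / C"
      proof (cases "z n = 0")
        case False
        have "D powr q = C" using q \<open>C \<ge> 0\<close> by (simp add: D_def powr_powr)
        then show ?thesis
          using False n by (simp add: seq_restrict_def norma powr_divide powr_powr q)
      qed (simp add: seq_restrict_def a_def)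
    qed
    also have "\<dots> = C / C" by (simp only: C_def sum_divide_distrib)
    also have "\<dots> \<le> 1" by simp
    finally have "(\<Sum>n. norm (seq_restrict A a n) powr q) \<le> 1" .
    moreover have "0 \<le> (\<Sum>n. norm (seq_restrict A a n) powr q)"
      using seq_restrict_finite_mem_conj_space[OF A, of a p] False
      by (intro suminf_nonneg) (simp_all add: conj_space_def lq_def q_def)
    ultimately have "(\<Sum>n. norm (seq_restrict A a n) powr q) powr (1 / q) \<le> 1 powr (1 / q)"
      using \<open>q > 1\<close> by (intro powr_mono2) auto
    then show ?thesis using False by (simp add: conj_norm_def lq_norm_def q_def)
  qed
  ultimately show ?thesis
    using that seq_restrict_finite_mem_conj_space[OF A] unfolding C_def by blast
qed

lemma conj_norm_unit_vector:
  assumes p: "p \<ge> 1"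
  shows "conj_norm p (seq_restrict {n} (\<lambda>_. 1 :: 'k::real_or_complex)) \<le> 1"
proof (cases "p = 1")
  case True
  then show ?thesis by (simp add: conj_norm_def sup_norm_def seq_restrict_def cSUP_least)
next
  case False
  have "(\<Sum>i. norm (seq_restrict {n} (\<lambda>_. 1 :: 'k) i) powr conjugate_exponent p)
      = (\<Sum>i\<in>{n}. norm (seq_restrict {n} (\<lambda>_. 1 :: 'k) i) powr conjugate_exponent p)"
    by (rule suminf_finite) (simp_all add: seq_restrict_def)
  then show ?thesis using False by (simp add: conj_norm_def lq_norm_def seq_restrict_def)
qed

section \<open>Functionals in the dual ball and weakly \<open>p\<close>-summable sequences\<close>

lemma continuous_linear_imp_bounded_linear:
  fixes T :: "'a::real_normed_vector \<Rightarrow> 'b::real_normed_vector"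
  assumes T: "linear T" and cont: "continuous_on UNIV T"
  shows "bounded_linear T"
proof -
  have "isCont T 0" using cont by (simp add: continuous_on_eq_continuous_at)
  then obtain d where d: "d > 0" "\<And>x. norm x < d \<Longrightarrow> norm (T x) < 1"
    using linear_0[OF T] unfolding continuous_at_eps_delta dist_norm
    by (metis diff_zero zero_less_one)
  have "norm (T x) \<le> norm x * (2 / d)" for x
  proof (cases "x = 0")
    case False
    have "norm (T ((d / (2 * norm x)) *\<^sub>R x)) < 1"
      using False d(1) by (intro d(2)) simp
    then show ?thesis
      using False d(1) by (simp add: linear_scale[OF T] field_simps)
  qed (simp add: linear_0[OF T])
  with T show ?thesis
    by (intro bounded_linear_intro[where K = "2 / d"]) (auto simp: linear_add linear_scale)
qed

context banach_over
begin

lemma dual_ball_linear: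
  assumes "f \<in> dual_ball scale"
  shows "Vector_Spaces.linear scale (*) f"
  using assms by (simp add: dual_ball_def operator_def)

lemma dual_ball_sum:
  assumes "f \<in> dual_ball scale"
  shows "f (\<Sum>n\<in>A. scale (a n) (x n)) = (\<Sum>n\<in>A. a n * f (x n))"
proof -
  interpret f: Vector_Spaces.linear scale "(*)" f by (rule dual_ball_linear[OF assms])
  show ?thesis by (simp add: f.sum f.scale)
qed

lemma dual_ball_bounded_linear:
  assumes f: "f \<in> dual_ball scale"
  shows "bounded_linear f"
proof (rule continuous_linear_imp_bounded_linear)
  interpret f: Vector_Spaces.linear scale "(*)" f by (rule dual_ball_linear[OF f])
  show "linear f"
  proof (rule linearI)
    show "f (r *\<^sub>R x) = r *\<^sub>R f x" for r x
      using f.scale[of "of_real r" x] by (simp add: scale_of_real scaleR_conv_of_real)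
  qed (rule f.add)
  show "continuous_on UNIV f" using f by (simp add: dual_ball_def operator_def)
qed

lemma dual_ball_le_norm:
  assumes f: "f \<in> dual_ball scale"
  shows "norm (f x) \<le> norm x"
proof -
  have "norm (f x) \<le> onorm f * norm x"
    by (rule onorm[OF dual_ball_bounded_linear[OF f]])
  also have "\<dots> \<le> 1 * norm x"
    using f by (intro mult_right_mono) (auto simp: dual_ball_def)
  finally show ?thesis by simp
qed

lemma dual_ball_diff: "f \<in> dual_ball scale \<Longrightarrow> f (x - y) = f x - f y"
  using bounded_linear.linear[OF dual_ball_bounded_linear] linear_diff by blast

lemma dual_ball_nonempty: "dual_ball scale \<noteq> {}"
  using norming_functional by blast

lemma norm_le_if_dual_ball_le:
  assumes "\<And>f. f \<in> dual_ball scale \<Longrightarrow> norm (f x) \<le> B"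
  shows "norm x \<le> B"
  using norming_functional[of x] assms by metis

text \<open>
  A uniform bound on partial sums already implies the convergence of the series, so
  later arguments need only finite sums.
\<close>
lemma weakly_p_summable_iff_bounded:
  assumes p: "p \<ge> 1"
  shows "weakly_p_summable scale p x \<longleftrightarrow>
    (\<exists>M. \<forall>f\<in>dual_ball scale. \<forall>N. (\<Sum>n<N. norm (f (x n)) powr p) \<le> M)"
proof
  assume wps: "weakly_p_summable scale p x"
  then obtain B where B: "\<And>f. f \<in> dual_ball scale \<Longrightarrow> (\<Sum>n. norm (f (x n)) powr p) powr (1 / p) \<le> B"
    unfolding weakly_p_summable_def bdd_above_def by auto
  have "(\<Sum>n<N. norm (f (x n)) powr p) \<le> B powr p" if f: "f \<in> dual_ball scale" for f N
  proof -
    have sm: "summable (\<lambda>n. norm (f (x n)) powr p)"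
      using wps f by (simp add: weakly_p_summable_def)
    have "(\<Sum>n<N. norm (f (x n)) powr p) \<le> (\<Sum>n. norm (f (x n)) powr p)"
      by (intro sum_le_suminf sm) auto
    also have "\<dots> = ((\<Sum>n. norm (f (x n)) powr p) powr (1 / p)) powr p"
      using p sm by (simp add: powr_powr suminf_nonneg)
    also have "\<dots> \<le> B powr p"
      using B[OF f] p by (intro powr_mono2) auto
    finally show ?thesis .
  qed
  then show "\<exists>M. \<forall>f\<in>dual_ball scale. \<forall>N. (\<Sum>n<N. norm (f (x n)) powr p) \<le> M" by blast
next
  assume "\<exists>M. \<forall>f\<in>dual_ball scale. \<forall>N. (\<Sum>n<N. norm (f (x n)) powr p) \<le> M"
  then obtain M where M: "\<And>f N. f \<in> dual_ball scale \<Longrightarrow> (\<Sum>n<N. norm (f (x n)) powr p) \<le> M"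
    by blast
  have sm: "summable (\<lambda>n. norm (f (x n)) powr p)" if "f \<in> dual_ball scale" for f
    by (rule summableI_nonneg_bounded[OF _ M[OF that]]) simp
  have "(\<Sum>n. norm (f (x n)) powr p) powr (1 / p) \<le> M powr (1 / p)" if "f \<in> dual_ball scale" for f
    using p sm[OF that] M[OF that] by (intro powr_mono2 suminf_le_const suminf_nonneg) auto
  with sm show "weakly_p_summable scale p x"
    unfolding weakly_p_summable_def by (auto intro!: bdd_aboveI2)
qed

lemma weakly_p_summable_tendsto_0:
  assumes p: "p \<ge> 1" and x: "weakly_p_summable scale p x" and f: "f \<in> dual_ball scale"
  shows "(\<lambda>n. f (x n)) \<longlonglongrightarrow> 0"
proof -
  have "summable (\<lambda>n. norm (f (x n)) powr p)"
    using x f by (simp add: weakly_p_summable_def)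
  then have "(\<lambda>n. norm (f (x n)) powr p) \<longlonglongrightarrow> 0" by (rule summable_LIMSEQ_zero)
  then have "(\<lambda>n. (norm (f (x n)) powr p) powr (1 / p)) \<longlonglongrightarrow> 0"
    by (rule tendsto_zero_powrI[where b = "1 / p"]) (use p in auto)
  then show ?thesis using p by (simp add: powr_powr tendsto_norm_zero_iff)
qed

lemma unconditionally_p_summable_iff_tails:
  assumes p: "p \<ge> 1"
  shows "unconditionally_p_summable scale p x \<longleftrightarrow> weakly_p_summable scale p x \<and>
    (\<forall>e>0. \<exists>m. \<forall>f\<in>dual_ball scale. \<forall>N. (\<Sum>n\<in>{m..<N}. norm (f (x n)) powr p) powr (1 / p) \<le> e)"
proof (cases "weakly_p_summable scale p x")
  case False
  then show ?thesis by (simp add: unconditionally_p_summable_def)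
next
  case wps: True
  define t where "t f m = (\<Sum>n. norm (f (x (n + m))) powr p) powr (1 / p)" for f :: "'a \<Rightarrow> 'k" and m
  have sm: "summable (\<lambda>n. norm (f (x n)) powr p)" if "f \<in> dual_ball scale" for f
    using wps that by (simp add: weakly_p_summable_def)
  note smm = summable_ignore_initial_segment[OF sm]
  have shift: "(\<Sum>n\<in>{m..<m + k}. norm (f (x n)) powr p) = (\<Sum>n<k. norm (f (x (n + m))) powr p)"
    for f :: "'a \<Rightarrow> 'k" and m k
    using sum.shift_bounds_nat_ivl[of "\<lambda>n. norm (f (x n)) powr p" 0 m k]
    by (simp add: atLeast0LessThan add.commute)
  have part: "(\<Sum>n\<in>{m..<N}. norm (f (x n)) powr p) powr (1 / p) \<le> t f m"
    if f: "f \<in> dual_ball scale" for f m N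
  proof -
    have "(\<Sum>n\<in>{m..<N}. norm (f (x n)) powr p) \<le> (\<Sum>n\<in>{m..<m + N}. norm (f (x n)) powr p)"
      by (intro sum_mono2) auto
    also have "\<dots> \<le> (\<Sum>n. norm (f (x (n + m))) powr p)"
      unfolding shift by (intro sum_le_suminf smm[OF f]) auto
    finally show ?thesis unfolding t_def using p by (intro powr_mono2) (auto intro: sum_nonneg)
  qed
  \<comment> \<open>The tail sum \<open>t f m\<close> is the least upper bound of the finite block sums that start at \<open>m\<close>.\<close>
  have t_le: "t f m \<le> e" if f: "f \<in> dual_ball scale" and e: "e \<ge> 0"
    and le: "\<And>N. (\<Sum>n\<in>{m..<N}. norm (f (x n)) powr p) powr (1 / p) \<le> e" for f m e
  proof -
    have "(\<Sum>n<k. norm (f (x (n + m))) powr p) \<le> e powr p" for k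
    proof -
      have "(\<Sum>n\<in>{m..<m + k}. norm (f (x n)) powr p)
          = ((\<Sum>n\<in>{m..<m + k}. norm (f (x n)) powr p) powr (1 / p)) powr p"
        using p by (simp add: powr_powr sum_nonneg)
      also have "\<dots> \<le> e powr p" using p le by (intro powr_mono2) auto
      finally show ?thesis unfolding shift .
    qed
    then have "(\<Sum>n. norm (f (x (n + m))) powr p) \<le> e powr p"
      by (intro suminf_le_const smm[OF f])
    then have "t f m \<le> (e powr p) powr (1 / p)"
      unfolding t_def using p smm[OF f] by (intro powr_mono2 suminf_nonneg) auto
    then show ?thesis using p e by (simp add: powr_powr)
  qed
  have bdd: "bdd_above ((\<lambda>f. t f m) ` dual_ball scale)" for m
  proof -
    obtain B where B: "\<And>f. f \<in> dual_ball scale \<Longrightarrow> (\<Sum>n. norm (f (x n)) powr p) powr (1 / p) \<le> B"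
      using wps unfolding weakly_p_summable_def bdd_above_def by auto
    have "t f m \<le> B" if f: "f \<in> dual_ball scale" for f
    proof -
      have "t f m \<le> t f 0"
      proof (rule t_le[OF f])
        show "t f 0 \<ge> 0" by (simp add: t_def)
        fix N
        have "(\<Sum>n\<in>{m..<N}. norm (f (x n)) powr p) powr (1 / p)
            \<le> (\<Sum>n\<in>{0..<N}. norm (f (x n)) powr p) powr (1 / p)"
          using p by (intro powr_mono2 sum_mono2) (auto intro: sum_nonneg)
        also have "\<dots> \<le> t f 0" by (rule part[OF f])
        finally show "(\<Sum>n\<in>{m..<N}. norm (f (x n)) powr p) powr (1 / p) \<le> t f 0" .
      qed
      also have "\<dots> \<le> B" using B[OF f] by (simp add: t_def)
      finally show ?thesis .
    qed
    then show ?thesis by (auto intro!: bdd_aboveI2)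
  qed
  have "((\<lambda>m. SUP f\<in>dual_ball scale. t f m) \<longlonglongrightarrow> 0) \<longleftrightarrow>
    (\<forall>e>0. \<exists>m. \<forall>f\<in>dual_ball scale. \<forall>N. (\<Sum>n\<in>{m..<N}. norm (f (x n)) powr p) powr (1 / p) \<le> e)"
    (is "?lim \<longleftrightarrow> ?tails")
  proof
    assume ?lim
    show ?tails
    proof (intro allI impI)
      fix e :: real assume "e > 0"
      then obtain m where m: "norm ((SUP f\<in>dual_ball scale. t f m) - 0) < e"
        using LIMSEQ_D[OF \<open>?lim\<close>] by blast
      have "(\<Sum>n\<in>{m..<N}. norm (f (x n)) powr p) powr (1 / p) \<le> e" if f: "f \<in> dual_ball scale" for f N
        using part[OF f, of m N] cSUP_upper[OF f bdd, of m] m by auto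
      then show "\<exists>m. \<forall>f\<in>dual_ball scale. \<forall>N. (\<Sum>n\<in>{m..<N}. norm (f (x n)) powr p) powr (1 / p) \<le> e"
        by blast
    qed
  next
    assume tails: ?tails
    show ?lim
    proof (rule LIMSEQ_I)
      fix e :: real assume "e > 0"
      then obtain m where m: "\<And>f N. f \<in> dual_ball scale \<Longrightarrow>
          (\<Sum>n\<in>{m..<N}. norm (f (x n)) powr p) powr (1 / p) \<le> e / 2"
        using tails by (metis half_gt_zero)
      have "norm ((SUP f\<in>dual_ball scale. t f k) - 0) < e" if "k \<ge> m" for k
      proof -
        have "t f k \<le> e / 2" if f: "f \<in> dual_ball scale" for f
        proof (rule t_le[OF f])
          show "e / 2 \<ge> 0" using \<open>e > 0\<close> by simp
          fix N
          have "(\<Sum>n\<in>{k..<N}. norm (f (x n)) powr p) powr (1 / p)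
              \<le> (\<Sum>n\<in>{m..<N}. norm (f (x n)) powr p) powr (1 / p)"
            using p \<open>k \<ge> m\<close> by (intro powr_mono2 sum_mono2) (auto intro: sum_nonneg)
          also have "\<dots> \<le> e / 2" by (rule m[OF f])
          finally show "(\<Sum>n\<in>{k..<N}. norm (f (x n)) powr p) powr (1 / p) \<le> e / 2" .
        qed
        then have "(SUP f\<in>dual_ball scale. t f k) \<le> e / 2"
          by (intro cSUP_least dual_ball_nonempty)
        moreover obtain f where f: "f \<in> dual_ball scale" using dual_ball_nonempty by blast
        have "0 \<le> t f k" by (simp add: t_def)
        with cSUP_upper[OF f bdd, of k] have "0 \<le> (SUP f\<in>dual_ball scale. t f k)" by linarith
        ultimately show ?thesis using \<open>e > 0\<close> by simp
      qed
      then show "\<exists>no. \<forall>n\<ge>no. norm ((SUP f\<in>dual_ball scale. t f n) - 0) < e" by blast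
    qed
  qed
  then show ?thesis using wps by (simp add: unconditionally_p_summable_def t_def)
qed

text \<open>
  This converts smallness of weak \<open>l\<^sub>p\<close> sums into norm estimates, for example for the tails of
  \<open>\<Sum> a\<^sub>n x\<^sub>n\<close>.
\<close>
lemma norm_combination_le:
  assumes p: "p \<ge> 1" and a: "a \<in> conj_space p" and A: "finite A"
    and B: "\<And>f. f \<in> dual_ball scale \<Longrightarrow> (\<Sum>n\<in>A. norm (f (x n)) powr p) powr (1 / p) \<le> B"
  shows "norm (\<Sum>n\<in>A. scale (a n) (x n)) \<le> conj_norm p a * B"
proof (rule norm_le_if_dual_ball_le)
  fix f assume f: "f \<in> dual_ball scale"
  have "norm (f (\<Sum>n\<in>A. scale (a n) (x n))) = norm (\<Sum>n\<in>A. a n * f (x n))"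
    by (simp add: dual_ball_sum[OF f])
  also have "\<dots> \<le> (\<Sum>n\<in>A. norm (a n) * norm (f (x n)))"
    by (rule order_trans[OF norm_sum]) (simp add: norm_mult)
  also have "\<dots> \<le> conj_norm p a * (\<Sum>n\<in>A. norm (f (x n)) powr p) powr (1 / p)"
    by (rule conj_norm_pairing[OF p a A]) simp
  also have "\<dots> \<le> conj_norm p a * B"
    by (intro mult_left_mono B f conj_norm_nonneg p a)
  finally show "norm (f (\<Sum>n\<in>A. scale (a n) (x n))) \<le> conj_norm p a * B" .
qed

lemma weakly_p_summable_subseq:
  assumes p: "p \<ge> 1" and x: "weakly_p_summable scale p x" and r: "strict_mono r"
  shows "weakly_p_summable scale p (\<lambda>n. x (r n))"
proof -
  obtain M where M: "\<And>f N. f \<in> dual_ball scale \<Longrightarrow> (\<Sum>n<N. norm (f (x n)) powr p) \<le> M"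
    using x unfolding weakly_p_summable_iff_bounded[OF p] by blast
  have "(\<Sum>n<N. norm (f (x (r n))) powr p) \<le> M" if "f \<in> dual_ball scale" for f N
  proof -
    have "(\<Sum>n<N. norm (f (x (r n))) powr p) = (\<Sum>n\<in>r ` {..<N}. norm (f (x n)) powr p)"
      using strict_mono_imp_inj_on[OF r] by (subst sum.reindex) (auto intro: inj_on_subset)
    also have "\<dots> \<le> (\<Sum>n<r N. norm (f (x n)) powr p)"
      using r by (intro sum_mono2) (auto simp: strict_mono_less)
    also have "\<dots> \<le> M" by (rule M[OF that])
    finally show ?thesis .
  qed
  then show ?thesis unfolding weakly_p_summable_iff_bounded[OF p] by blast
qed

lemma weakly_p_summable_diff:
  assumes p: "p \<ge> 1" and x: "weakly_p_summable scale p x" and y: "weakly_p_summable scale p y"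
  shows "weakly_p_summable scale p (\<lambda>n. x n - y n)"
proof -
  obtain M where M: "\<And>f N. f \<in> dual_ball scale \<Longrightarrow> (\<Sum>n<N. norm (f (x n)) powr p) \<le> M"
    using x unfolding weakly_p_summable_iff_bounded[OF p] by blast
  obtain L where L: "\<And>f N. f \<in> dual_ball scale \<Longrightarrow> (\<Sum>n<N. norm (f (y n)) powr p) \<le> L"
    using y unfolding weakly_p_summable_iff_bounded[OF p] by blast
  have "(\<Sum>n<N. norm (f (x n - y n)) powr p) \<le> 2 powr p * (M + L)" if f: "f \<in> dual_ball scale" for f N
  proof -
    have "norm (f (x n - y n)) powr p \<le> 2 powr p * (norm (f (x n)) powr p + norm (f (y n)) powr p)" for n
    proof -
      let ?m = "max (norm (f (x n))) (norm (f (y n)))"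
      have "norm (f (x n - y n)) \<le> norm (f (x n)) + norm (f (y n))"
        unfolding dual_ball_diff[OF f] by (rule norm_triangle_ineq4)
      also have "\<dots> \<le> 2 * ?m" by simp
      finally have "norm (f (x n - y n)) powr p \<le> (2 * ?m) powr p"
        using p by (intro powr_mono2) auto
      also have "\<dots> = 2 powr p * ?m powr p" by (simp add: powr_mult)
      also have "\<dots> \<le> 2 powr p * (norm (f (x n)) powr p + norm (f (y n)) powr p)"
        by (intro mult_left_mono) (auto simp: max_def)
      finally show ?thesis .
    qed
    then have "(\<Sum>n<N. norm (f (x n - y n)) powr p)
        \<le> (\<Sum>n<N. 2 powr p * (norm (f (x n)) powr p + norm (f (y n)) powr p))"
      by (rule sum_mono)
    also have "\<dots> = 2 powr p * ((\<Sum>n<N. norm (f (x n)) powr p) + (\<Sum>n<N. norm (f (y n)) powr p))"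
      by (simp only: sum_distrib_left[symmetric] sum.distrib)
    also have "\<dots> \<le> 2 powr p * (M + L)"
      by (intro mult_left_mono add_mono M L f) simp
    finally show ?thesis .
  qed
  then show ?thesis unfolding weakly_p_summable_iff_bounded[OF p] by blast
qed

lemma weakly_p_convergent_imp_Cauchy:
  assumes p: "p \<ge> 1" and "weakly_p_convergent scale p x"
  shows "weakly_p_Cauchy scale p x"
  unfolding weakly_p_Cauchy_def
proof (intro allI impI)
  fix k j :: "nat \<Rightarrow> nat" assume kj: "strict_mono k" "strict_mono j"
  obtain l where l: "weakly_p_summable scale p (\<lambda>n. x n - l)"
    using assms(2) by (auto simp: weakly_p_convergent_def)
  from weakly_p_summable_diff[OF p weakly_p_summable_subseq[OF p l kj(1)] weakly_p_summable_subseq[OF p l kj(2)]]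
  show "weakly_p_summable scale p (\<lambda>n. x (k n) - x (j n))" by simp
qed

lemma precompact_imp_conditionally_compact:
  assumes "p \<ge> 1" and "relatively_weakly_p_precompact scale p K"
  shows "conditionally_weakly_p_compact scale p K"
  using assms weakly_p_convergent_imp_Cauchy
  unfolding relatively_weakly_p_precompact_def conditionally_weakly_p_compact_def by meson

lemma constant_or_increasing_subseq:
  fixes j :: "nat \<Rightarrow> nat"
  shows "\<exists>r :: nat \<Rightarrow> nat. strict_mono r \<and> (strict_mono (\<lambda>n. j (r n)) \<or> (\<exists>v. \<forall>n. j (r n) = v))"
proof (cases "\<exists>v. infinite {n. j n = v}")
  case True
  then obtain v where "infinite {n. j n = v}" by blast
  from infinite_enumerate[OF this] show ?thesis by auto
next
  case False
  \<comment> \<open>All fibres of \<open>j\<close> are finite, so only finitely many indices have a value of at most \<open>j n\<close>.\<close>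
  have "\<exists>n'>n. j n < j n'" for n
  proof -
    have "finite (\<Union>v\<le>j n. {i. j i = v})" using False by simp
    then have "finite ((\<Union>v\<le>j n. {i. j i = v}) \<union> {..n})" by simp
    then obtain n' where "n' \<notin> (\<Union>v\<le>j n. {i. j i = v}) \<union> {..n}"
      using infinite_UNIV_nat by (metis ex_new_if_finite)
    then show ?thesis by (intro exI[of _ n']) auto
  qed
  then have "\<exists>r. \<forall>n. True \<and> (r n < r (Suc n) \<and> j (r n) < j (r (Suc n)))"
    by (intro dependent_nat_choice) auto
  then obtain r where "\<And>n. r n < r (Suc n)" "\<And>n. j (r n) < j (r (Suc n))" by blast
  then show ?thesis by (auto simp: strict_mono_Suc_iff)
qed

text \<open>
  A sequence in the range has a subsequence that is constant, hence trivially convergent to its value,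
  or a subsequence of \<open>x\<close>, hence weakly \<open>p\<close>-convergent to zero.
\<close>
lemma range_weakly_p_precompact:
  assumes p: "p \<ge> 1" and x: "weakly_p_summable scale p x"
  shows "relatively_weakly_p_precompact scale p (range x)"
  unfolding relatively_weakly_p_precompact_def
proof (intro allI impI)
  fix y :: "nat \<Rightarrow> 'a" assume "range y \<subseteq> range x"
  then have "\<forall>n. \<exists>i. y n = x i" by blast
  then obtain j where j: "\<And>n. y n = x (j n)" by metis
  obtain r :: "nat \<Rightarrow> nat" where r: "strict_mono r"
    and jr: "strict_mono (\<lambda>n. j (r n)) \<or> (\<exists>v. \<forall>n. j (r n) = v)"
    using constant_or_increasing_subseq by blast
  from jr have "weakly_p_convergent scale p (y \<circ> r)"
  proof
    assume "\<exists>v. \<forall>n. j (r n) = v"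
    then obtain v where const: "\<And>n. j (r n) = v" by blast
    have zero: "f 0 = 0" if "f \<in> dual_ball scale" for f
      using dual_ball_le_norm[OF that, of 0] by simp
    then have "weakly_p_summable scale p (\<lambda>n. 0)"
      unfolding weakly_p_summable_iff_bounded[OF p] by (intro exI[of _ 0]) (simp add: zero)
    then show ?thesis
      unfolding weakly_p_convergent_def by (intro exI[of _ "x v"]) (simp add: j const)
  next
    assume "strict_mono (\<lambda>n. j (r n))"
    from weakly_p_summable_subseq[OF p x this] show ?thesis
      unfolding weakly_p_convergent_def by (intro exI[of _ 0]) (simp add: j)
  qed
  with r show "\<exists>r. strict_mono r \<and> weakly_p_convergent scale p (y \<circ> r)" by blast
qed

text \<open>
  Every norm cluster point of a weakly null sequence is annihilated by a functional that norms it.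
\<close>
lemma weakly_null_relatively_compact_imp_null:
  assumes weak: "\<And>f. f \<in> dual_ball scale \<Longrightarrow> (\<lambda>n. f (y n)) \<longlonglongrightarrow> 0"
    and comp: "relatively_norm_compact (range y)"
  shows "y \<longlonglongrightarrow> 0"
proof (rule ccontr)
  assume "\<not> y \<longlonglongrightarrow> 0"
  then obtain e where e: "e > 0" "\<And>N. \<exists>n\<ge>N. norm (y n) \<ge> e"
    unfolding LIMSEQ_iff by (auto simp: not_less)
  then have "infinite {n. norm (y n) \<ge> e}"
    unfolding infinite_nat_iff_unbounded_le by blast
  from infinite_enumerate[OF this] obtain r :: "nat \<Rightarrow> nat"
    where r: "strict_mono r" "\<And>n. norm (y (r n)) \<ge> e" by auto
  have "\<forall>n. y (r n) \<in> closure (range y)"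
    using closure_subset[of "range y"] by auto
  then obtain l s where s: "strict_mono (s :: nat \<Rightarrow> nat)" and lim: "((\<lambda>n. y (r n)) \<circ> s) \<longlonglongrightarrow> l"
    using comp unfolding relatively_norm_compact_def compact_def by meson
  have rs: "strict_mono (r \<circ> s)" by (rule strict_mono_o[OF r(1) s])
  obtain f where f: "f \<in> dual_ball scale" "norm (f l) = norm l"
    by (rule norming_functional)
  have "(\<lambda>n. f (((\<lambda>n. y (r n)) \<circ> s) n)) \<longlonglongrightarrow> f l"
    by (rule bounded_linear.tendsto[OF dual_ball_bounded_linear[OF f(1)] lim])
  moreover have "(\<lambda>n. f (((\<lambda>n. y (r n)) \<circ> s) n)) \<longlonglongrightarrow> 0"
    using LIMSEQ_subseq_LIMSEQ[OF weak[OF f(1)] rs] by (simp add: o_def)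
  ultimately have "f l = 0" by (rule LIMSEQ_unique)
  with f(2) have "l = 0" by simp
  with lim have "(\<lambda>n. norm (y (r (s n)))) \<longlonglongrightarrow> 0" by (simp add: o_def tendsto_norm_zero_iff)
  then have "e \<le> 0" using r(2) by (intro LIMSEQ_le_const[of _ 0]) auto
  with e(1) show False by simp
qed

end

section \<open>Criteria for relative compactness\<close>

lemma relatively_norm_compactI_subseq:
  fixes K :: "'a::real_normed_vector set"
  assumes "\<And>y :: nat \<Rightarrow> 'a. range y \<subseteq> K \<Longrightarrow> \<exists>r l. strict_mono (r :: nat \<Rightarrow> nat) \<and> (\<lambda>n. y (r n)) \<longlonglongrightarrow> l"
  shows "relatively_norm_compact K"
  unfolding relatively_norm_compact_def compact_def
proof (intro allI impI)
  fix z :: "nat \<Rightarrow> 'a" assume z: "\<forall>n. z n \<in> closure K"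
  have "\<exists>y\<in>K. dist y (z n) < inverse (real (Suc n))" for n
    using z by (simp add: closure_approachable)
  then obtain y where y: "\<And>n. y n \<in> K" "\<And>n. dist (y n) (z n) < inverse (real (Suc n))" by metis
  obtain r l where r: "strict_mono r" and l: "(\<lambda>n. y (r n)) \<longlonglongrightarrow> l"
    using assms[of y] y(1) by blast
  have "(\<lambda>n. z n - y n) \<longlonglongrightarrow> 0"
    by (rule Lim_null_comparison[OF _ LIMSEQ_inverse_real_of_nat])
      (use y(2) in \<open>auto simp: dist_norm norm_minus_commute intro!: always_eventually less_imp_le\<close>)
  from tendsto_add[OF LIMSEQ_subseq_LIMSEQ[OF this r] l]
  have lim: "(z \<circ> r) \<longlonglongrightarrow> l" by (simp add: o_def)
  have "l \<in> closure K"
    using lim z closed_sequentially[OF closed_closure, of "z \<circ> r" K l] by simp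
  with r lim show "\<exists>l\<in>closure K. \<exists>r. strict_mono r \<and> (z \<circ> r) \<longlonglongrightarrow> l" by blast
qed

text \<open>
  A set that is approximated uniformly by compact sets is totally bounded. This is how the compactness
  of a uniform limit of finite rank maps is obtained.
\<close>
lemma relatively_norm_compactI_approx:
  fixes K :: "'a::banach set"
  assumes "\<And>e. e > 0 \<Longrightarrow> \<exists>Q. compact Q \<and> (\<forall>y\<in>K. \<exists>q\<in>Q. dist y q \<le> e)"
  shows "relatively_norm_compact K"
  unfolding relatively_norm_compact_def compact_eq_totally_bounded
proof (intro conjI allI impI)
  show "complete (closure K)" by (simp add: complete_eq_closed)
  fix e :: real assume "e > 0"
  then obtain Q where Q: "compact Q" "\<And>y. y \<in> K \<Longrightarrow> \<exists>q\<in>Q. dist y q \<le> e / 4"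
    using assms[of "e / 4"] by auto
  have "\<exists>k. finite k \<and> Q \<subseteq> (\<Union>x\<in>k. ball x (e / 4))"
    using Q(1) \<open>e > 0\<close> unfolding compact_eq_totally_bounded by auto
  then obtain k where k: "finite k" "Q \<subseteq> (\<Union>x\<in>k. ball x (e / 4))" by blast
  have "z \<in> (\<Union>x\<in>k. ball x e)" if z: "z \<in> closure K" for z
  proof -
    obtain y where y: "y \<in> K" "dist y z < e / 4"
      using z \<open>e > 0\<close> closure_approachable[of z K] by (metis divide_pos_pos zero_less_numeral)
    obtain q where q: "q \<in> Q" "dist y q \<le> e / 4" using Q(2)[OF y(1)] by blast
    obtain x where x: "x \<in> k" "dist x q < e / 4" using k(2) q(1) by auto
    have "dist x z \<le> dist x q + dist y q + dist y z" by metric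
    with x(2) q(2) y(2) \<open>e > 0\<close> have "dist x z < e" by linarith
    with x(1) show ?thesis by auto
  qed
  with k(1) show "\<exists>k. finite k \<and> closure K \<subseteq> (\<Union>x\<in>k. ball x e)" by blast
qed

text \<open>
  The ball is a continuous image of a real interval or, under the isometry \<open>\<phi>\<close>, of the complex disc.
\<close>
lemma compact_scalar_ball: "compact {c :: 'k::real_or_complex. norm c \<le> 1}"
  using real_or_complex[where ?'a = 'k]
proof (elim disjE exE conjE)
  assume surj: "surj (\<lambda>r. r *\<^sub>R (1 :: 'k))"
  have "{c :: 'k. norm c \<le> 1} = (\<lambda>r. r *\<^sub>R 1) ` {-1..1}"
  proof (intro equalityI subsetI)
    fix c :: 'k assume c: "c \<in> {c. norm c \<le> 1}"
    obtain r where r: "c = r *\<^sub>R 1" using surjD[OF surj] by blast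
    then have "r \<in> {-1..1}" using c by (auto simp: abs_le_iff)
    with r show "c \<in> (\<lambda>r. r *\<^sub>R 1) ` {-1..1}" by blast
  qed auto
  also have "compact \<dots>"
    by (intro compact_continuous_image continuous_intros) auto
  finally show ?thesis .
next
  fix \<phi> :: "complex \<Rightarrow> 'k"
  assume bij: "bij \<phi>" and add: "\<forall>z w. \<phi> (z + w) = \<phi> z + \<phi> w"
    and nrm: "\<forall>z. norm (\<phi> z) = norm z"
  have "dist (\<phi> z) (\<phi> w) = dist z w" for z w
  proof -
    have "\<phi> z - \<phi> w = \<phi> (z - w)" using add by (metis add_diff_cancel diff_add_cancel)
    then show ?thesis using nrm by (simp add: dist_norm)
  qed
  then have "continuous_on (cball 0 1) \<phi>" unfolding continuous_on_iff by auto
  then have "compact (\<phi> ` cball 0 1)" by (rule compact_continuous_image) (rule compact_cball)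
  also have "\<phi> ` cball 0 1 = {c. norm c \<le> 1}"
  proof (intro equalityI subsetI)
    fix c :: 'k assume "c \<in> {c. norm c \<le> 1}"
    moreover obtain z where "c = \<phi> z" using bij by (metis bij_pointE)
    ultimately show "c \<in> \<phi> ` cball 0 1" using nrm by auto
  qed (use nrm in auto)
  finally show ?thesis .
qed

lemma (in banach_over) compact_combinations:
  fixes y :: "nat \<Rightarrow> 'a"
  shows "compact {\<Sum>n<m. scale (a n) (y n) | a. \<forall>n. norm (a n) \<le> 1}"
proof (induction m)
  case 0
  have "{\<Sum>n<0. scale (a n) (y n) | a. \<forall>n. norm (a n) \<le> 1} = {0}"
    by (auto intro!: exI[of _ "\<lambda>_. 0"])
  then show ?case by (simp only: compact_sing)
next
  case (Suc m)
  let ?B = "{c :: 'k. norm c \<le> 1}"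
  let ?Q = "\<lambda>m. {\<Sum>n<m. scale (a n) (y n) | a. \<forall>n. norm (a n) \<le> 1}"
  have "bounded_linear (\<lambda>c. scale c (y m))"
  proof (rule bounded_linear_intro[where K = "norm (y m)"])
    show "scale (r *\<^sub>R c) (y m) = r *\<^sub>R scale c (y m)" for r c
      using scale_of_real[of r "scale c (y m)"] by (simp add: scaleR_conv_of_real)
  qed (simp_all add: scale_left_distrib norm_scale)
  then have "compact ((\<lambda>c. scale c (y m)) ` ?B)"
    by (intro compact_continuous_image compact_scalar_ball linear_continuous_on)
  with Suc have "compact {u + v | u v. u \<in> ?Q m \<and> v \<in> (\<lambda>c. scale c (y m)) ` ?B}"
    by (intro compact_sums)
  also have "{u + v | u v. u \<in> ?Q m \<and> v \<in> (\<lambda>c. scale c (y m)) ` ?B} = ?Q (Suc m)"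
  proof (intro equalityI subsetI)
    fix w assume "w \<in> {u + v | u v. u \<in> ?Q m \<and> v \<in> (\<lambda>c. scale c (y m)) ` ?B}"
    then obtain a c where a: "\<forall>n. norm (a n) \<le> 1" "norm c \<le> 1"
      and w: "w = (\<Sum>n<m. scale (a n) (y n)) + scale c (y m)" by auto
    have "w = (\<Sum>n<Suc m. scale ((a(m := c)) n) (y n))" by (simp add: w)
    moreover have "\<forall>n. norm ((a(m := c)) n) \<le> 1" using a by simp
    ultimately show "w \<in> ?Q (Suc m)" by blast
  next
    fix w assume "w \<in> ?Q (Suc m)"
    then obtain a where a: "\<forall>n. norm (a n) \<le> 1" and w: "w = (\<Sum>n<Suc m. scale (a n) (y n))" by blast
    have "w = (\<Sum>n<m. scale (a n) (y n)) + scale (a m) (y m)" by (simp add: w)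
    moreover have "scale (a m) (y m) \<in> (\<lambda>c. scale c (y m)) ` ?B" using a by (intro imageI) simp
    moreover have "(\<Sum>n<m. scale (a n) (y n)) \<in> ?Q m" using a by blast
    ultimately show "w \<in> {u + v | u v. u \<in> ?Q m \<and> v \<in> (\<lambda>c. scale c (y m)) ` ?B}" by blast
  qed
  finally show ?case .
qed

section \<open>\<open>p\<close>-converging operators\<close>

locale banach_operator = X: banach_over sX + Y: banach_over sY
  for sX :: "'k::real_or_complex \<Rightarrow> 'a::banach \<Rightarrow> 'a" and sY :: "'k \<Rightarrow> 'b::banach \<Rightarrow> 'b" +
  fixes T :: "'a \<Rightarrow> 'b" and p :: real
  assumes operator: "operator sX sY T" and p: "1 \<le> p"
begin

sublocale T: Vector_Spaces.linear sX sY T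
  using operator by (simp add: operator_def)

lemma bounded_linear_T: "bounded_linear T"
proof (rule continuous_linear_imp_bounded_linear)
  show "linear T"
  proof (rule linearI)
    show "T (r *\<^sub>R x) = r *\<^sub>R T x" for r x
      using T.scale[of "of_real r" x] by (simp add: X.scale_of_real Y.scale_of_real)
  qed (rule T.add)
  show "continuous_on UNIV T" using operator by (simp add: operator_def)
qed

text \<open>
  Composition with \<open>T\<close> maps the dual ball of the codomain into a multiple \<open>K\<close> of the dual ball of the
  domain.
\<close>
lemma weakly_p_summable_image:
  assumes x: "weakly_p_summable sX p x"
  shows "weakly_p_summable sY p (\<lambda>n. T (x n))"
proof -
  obtain K where K: "K > 0" "\<And>x. norm (T x) \<le> norm x * K"
    using bounded_linear.pos_bounded[OF bounded_linear_T] by blast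
  obtain M where M: "\<And>f N. f \<in> dual_ball sX \<Longrightarrow> (\<Sum>n<N. norm (f (x n)) powr p) \<le> M"
    using x unfolding X.weakly_p_summable_iff_bounded[OF p] by blast
  have "(\<Sum>n<N. norm (f (T (x n))) powr p) \<le> K powr p * M" if f: "f \<in> dual_ball sY" for f N
  proof -
    interpret f: Vector_Spaces.linear sY "(*)" f by (rule Y.dual_ball_linear[OF f])
    define g where "g x = of_real (1 / K) * f (T x)" for x
    have g: "g \<in> dual_ball sX"
    proof (rule X.dual_ballI)
      show "Vector_Spaces.linear sX (*) g"
        unfolding Vector_Spaces.linear_iff
        using Y.dual_ball_linear[OF f, unfolded Vector_Spaces.linear_iff]
        by (simp add: X.vector_space_axioms g_def T.add f.add T.scale f.scale
            algebra_simps)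
      show "norm (g x) \<le> norm x" for x
      proof -
        have "norm (f (T x)) \<le> norm x * K"
          using Y.dual_ball_le_norm[OF f, of "T x"] K(2)[of x] by linarith
        then show ?thesis using K(1) by (simp add: g_def norm_mult norm_divide field_simps)
      qed
    qed
    have "norm (f (T (x n))) powr p = K powr p * norm (g (x n)) powr p" for n
      using K(1) by (simp add: g_def norm_mult norm_divide flip: powr_mult)
    then have "(\<Sum>n<N. norm (f (T (x n))) powr p) = K powr p * (\<Sum>n<N. norm (g (x n)) powr p)"
      by (simp add: sum_distrib_left)
    also have "\<dots> \<le> K powr p * M" by (intro mult_left_mono M g) simp
    finally show ?thesis .
  qed
  then show ?thesis unfolding Y.weakly_p_summable_iff_bounded[OF p] by blast
qed

definition p_converging :: bool where
  "p_converging \<longleftrightarrow> (\<forall>x. weakly_p_summable sX p x \<longrightarrow> (\<lambda>n. T (x n)) \<longlonglongrightarrow> 0)"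

lemma p_converging_if_unconditionally:
  assumes "unconditionally_p_converging sX sY p T"
  shows p_converging
  unfolding p_converging_def
proof (intro allI impI)
  fix x assume "weakly_p_summable sX p x"
  then have "unconditionally_p_summable sY p (\<lambda>n. T (x n))"
    using assms by (simp add: unconditionally_p_converging_def)
  then have tails: "\<And>e. e > 0 \<Longrightarrow> \<exists>m. \<forall>f\<in>dual_ball sY. \<forall>N.
      (\<Sum>n\<in>{m..<N}. norm (f (T (x n))) powr p) powr (1 / p) \<le> e"
    unfolding Y.unconditionally_p_summable_iff_tails[OF p] by blast
  show "(\<lambda>n. T (x n)) \<longlonglongrightarrow> 0"
  proof (rule LIMSEQ_I)
    fix e :: real assume "e > 0"
    then obtain m where m: "\<And>f N. f \<in> dual_ball sY \<Longrightarrow>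
        (\<Sum>n\<in>{m..<N}. norm (f (T (x n))) powr p) powr (1 / p) \<le> e / 2"
      using tails[of "e / 2"] by auto
    have "norm (T (x n)) \<le> e / 2" if "n \<ge> m" for n
    proof (rule Y.norm_le_if_dual_ball_le)
      fix f assume f: "f \<in> dual_ball sY"
      have "norm (f (T (x n))) = (norm (f (T (x n))) powr p) powr (1 / p)"
        using p by (simp add: powr_powr)
      also have "norm (f (T (x n))) powr p \<le> (\<Sum>n\<in>{m..<Suc n}. norm (f (T (x n))) powr p)"
        using that by (intro member_le_sum) auto
      then have "(norm (f (T (x n))) powr p) powr (1 / p)
          \<le> (\<Sum>n\<in>{m..<Suc n}. norm (f (T (x n))) powr p) powr (1 / p)"
        using p by (intro powr_mono2) auto
      also have "\<dots> \<le> e / 2" by (rule m[OF f])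
      finally show "norm (f (T (x n))) \<le> e / 2" .
    qed
    then have "\<forall>n\<ge>m. norm (T (x n) - 0) < e"
      using \<open>e > 0\<close> by (auto intro: le_less_trans[of _ "e / 2"] simp del: le_divide_eq_numeral1)
    then show "\<exists>no. \<forall>n\<ge>no. norm (T (x n) - 0) < e" by blast
  qed
qed

text \<open>
  The coefficients of \<open>w\<close> are extremal for the numbers \<open>f (T x\<^sub>n)\<close>, which gives the lower bound for
  \<open>\<parallel>T w\<parallel>\<close>; they lie in the unit ball, which gives the upper bound for every \<open>g w\<close> by the pairing
  inequality. The second bound is additive in the set \<open>A\<close>, so it can be summed over disjoint blocks.
\<close>
lemma block_combination:
  fixes x :: "nat \<Rightarrow> 'a" and A :: "nat set"
  assumes f: "f \<in> dual_ball sY" and A: "finite A"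
  obtains w where "(\<Sum>n\<in>A. norm (f (T (x n))) powr p) powr (1 / p) \<le> norm (T w)"
    and "\<And>g. g \<in> dual_ball sX \<Longrightarrow> norm (g w) powr p \<le> (\<Sum>n\<in>A. norm (g (x n)) powr p)"
proof -
  obtain a where a: "seq_restrict A a \<in> conj_space p" "conj_norm p (seq_restrict A a) \<le> 1"
    and sum: "(\<Sum>n\<in>A. a n * f (T (x n))) = of_real ((\<Sum>n\<in>A. norm (f (T (x n))) powr p) powr (1 / p))"
    using conj_norm_attained[OF p A, of "\<lambda>n. f (T (x n))"] by blast
  define w where "w = (\<Sum>n\<in>A. sX (a n) (x n))"
  have "f (T w) = (\<Sum>n\<in>A. a n * f (T (x n)))"
    by (simp add: w_def T.sum T.scale Y.dual_ball_sum[OF f])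
  then have "norm (f (T w)) = (\<Sum>n\<in>A. norm (f (T (x n))) powr p) powr (1 / p)"
    unfolding sum by simp
  then have 1: "(\<Sum>n\<in>A. norm (f (T (x n))) powr p) powr (1 / p) \<le> norm (T w)"
    using Y.dual_ball_le_norm[OF f, of "T w"] by simp
  have 2: "norm (g w) powr p \<le> (\<Sum>n\<in>A. norm (g (x n)) powr p)" if g: "g \<in> dual_ball sX" for g
  proof -
    let ?s = "(\<Sum>n\<in>A. norm (g (x n)) powr p)"
    have "norm (g w) \<le> (\<Sum>n\<in>A. norm (a n) * norm (g (x n)))"
      unfolding w_def X.dual_ball_sum[OF g] by (rule order_trans[OF norm_sum]) (simp add: norm_mult)
    also have "\<dots> = (\<Sum>n\<in>A. norm (seq_restrict A a n) * norm (g (x n)))"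
      by (intro sum.cong) (simp_all add: seq_restrict_def)
    also have "\<dots> \<le> conj_norm p (seq_restrict A a) * ?s powr (1 / p)"
      by (rule conj_norm_pairing[OF p a(1) A]) simp
    also have "\<dots> \<le> 1 * ?s powr (1 / p)"
      by (intro mult_right_mono a(2)) simp
    finally have "norm (g w) powr p \<le> (?s powr (1 / p)) powr p"
      using p by (intro powr_mono2) auto
    then show ?thesis using p by (simp add: powr_powr sum_nonneg)
  qed
  from that[OF 1 2] show ?thesis .
qed

lemma unconditionally_if_p_converging:
  assumes pc: p_converging
  shows "unconditionally_p_converging sX sY p T"
  unfolding unconditionally_p_converging_def
proof (intro allI impI)
  fix x assume x: "weakly_p_summable sX p x"
  show "unconditionally_p_summable sY p (\<lambda>n. T (x n))"
    unfolding Y.unconditionally_p_summable_iff_tails[OF p]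
  proof (intro conjI weakly_p_summable_image[OF x], rule ccontr)
    assume "\<not> (\<forall>e>0. \<exists>m. \<forall>f\<in>dual_ball sY. \<forall>N.
        (\<Sum>n\<in>{m..<N}. norm (f (T (x n))) powr p) powr (1 / p) \<le> e)"
    then obtain e where e: "e > 0" and big: "\<And>m. \<exists>f\<in>dual_ball sY. \<exists>N.
        e < (\<Sum>n\<in>{m..<N}. norm (f (T (x n))) powr p) powr (1 / p)"
      by (auto simp: not_le)
    have "\<exists>N w. N \<ge> m \<and> e < norm (T w) \<and>
        (\<forall>g\<in>dual_ball sX. norm (g w) powr p \<le> (\<Sum>n\<in>{m..<N}. norm (g (x n)) powr p))" for m
    proof -
      obtain f N where f: "f \<in> dual_ball sY"
        and N: "e < (\<Sum>n\<in>{m..<N}. norm (f (T (x n))) powr p) powr (1 / p)" using big by blast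
      obtain w where "(\<Sum>n\<in>{m..<N}. norm (f (T (x n))) powr p) powr (1 / p) \<le> norm (T w)"
        and w: "\<And>g. g \<in> dual_ball sX \<Longrightarrow> norm (g w) powr p \<le> (\<Sum>n\<in>{m..<N}. norm (g (x n)) powr p)"
        using block_combination[OF f, of "{m..<N}" x] by blast
      with N have "e < norm (T w)" by simp
      moreover have "N \<ge> m" using N e by (cases "N \<ge> m") auto
      ultimately show ?thesis using w by blast
    qed
    then obtain N w where N: "\<And>m. N m \<ge> m" and Tw: "\<And>m. e < norm (T (w m))"
      and gw: "\<And>m g. g \<in> dual_ball sX \<Longrightarrow>
        norm (g (w m)) powr p \<le> (\<Sum>n\<in>{m..<N m}. norm (g (x n)) powr p)"
      by metis
    \<comment> \<open>Each block starts where the preceding one ends, so that together they exhaust an initial segment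
      and the bounds for \<open>g (w (m k))\<close> add up to a partial sum of the series for \<open>x\<close>.\<close>
    define m where "m k = (N ^^ k) 0" for k
    have "weakly_p_summable sX p (\<lambda>k. w (m k))"
    proof -
      obtain M where M: "\<And>f N. f \<in> dual_ball sX \<Longrightarrow> (\<Sum>n<N. norm (f (x n)) powr p) \<le> M"
        using x unfolding X.weakly_p_summable_iff_bounded[OF p] by blast
      have "(\<Sum>k<K. norm (g (w (m k))) powr p) \<le> M" if g: "g \<in> dual_ball sX" for g K
      proof -
        have "(\<Sum>k<K. norm (g (w (m k))) powr p) \<le> (\<Sum>n<m K. norm (g (x n)) powr p)"
        proof (induction K)
          case (Suc K)
          have "(\<Sum>n<m (Suc K). norm (g (x n)) powr p)
              = (\<Sum>n<m K. norm (g (x n)) powr p) + (\<Sum>n\<in>{m K..<N (m K)}. norm (g (x n)) powr p)"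
            using sum.atLeastLessThan_concat[of 0 "m K" "N (m K)" "\<lambda>n. norm (g (x n)) powr p"] N
            by (simp add: m_def atLeast0LessThan)
          with Suc gw[OF g, of "m K"] show ?case by simp
        qed (simp add: m_def)
        also have "\<dots> \<le> M" by (rule M[OF g])
        finally show ?thesis .
      qed
      then show ?thesis unfolding X.weakly_p_summable_iff_bounded[OF p] by blast
    qed
    then have "(\<lambda>k. T (w (m k))) \<longlonglongrightarrow> 0" using pc by (simp add: p_converging_def)
    then have "(\<lambda>k. norm (T (w (m k)))) \<longlonglongrightarrow> 0" by (rule tendsto_norm_zero)
    then have "e \<le> 0" using Tw by (intro LIMSEQ_le_const[of _ 0]) (auto intro: less_imp_le)
    with e show False by simp
  qed
qed

lemma conditionally_compact_image:
  assumes pc: p_converging and K: "conditionally_weakly_p_compact sX p K"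
  shows "relatively_norm_compact (T ` K)"
proof (rule relatively_norm_compactI_subseq)
  fix y :: "nat \<Rightarrow> 'b" assume "range y \<subseteq> T ` K"
  then have "\<forall>n. \<exists>x\<in>K. y n = T x" by blast
  then obtain x where x: "\<And>n. x n \<in> K" "\<And>n. y n = T (x n)" by metis
  from K x(1) obtain r where r: "strict_mono r" and C: "weakly_p_Cauchy sX p (x \<circ> r)"
    unfolding conditionally_weakly_p_compact_def by blast
  have "Cauchy (\<lambda>n. y (r n))"
  proof (rule ccontr)
    assume "\<not> Cauchy (\<lambda>n. y (r n))"
    then obtain e where e: "e > 0"
      and far: "\<And>M. \<exists>a\<ge>M. \<exists>b\<ge>M. e \<le> dist (y (r a)) (y (r b))"
      unfolding Cauchy_def by (auto simp: not_less)
    \<comment> \<open>Pairs of indices at distance at least \<open>e\<close> are chosen so that both components increase: these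
      are the two subsequences to which the weak Cauchy property applies.\<close>
    have "\<exists>s. \<forall>n. e \<le> dist (y (r (fst (s n)))) (y (r (snd (s n)))) \<and>
        (fst (s n) < fst (s (Suc n)) \<and> snd (s n) < snd (s (Suc n)))"
    proof (rule dependent_nat_choice)
      show "\<exists>ab. e \<le> dist (y (r (fst ab))) (y (r (snd ab)))" using far[of 0] by auto
      show "\<exists>cd. e \<le> dist (y (r (fst cd))) (y (r (snd cd))) \<and> fst ab < fst cd \<and> snd ab < snd cd"
        for ab :: "nat \<times> nat"
      proof -
        obtain a b where "a \<ge> Suc (max (fst ab) (snd ab))" "b \<ge> Suc (max (fst ab) (snd ab))"
          "e \<le> dist (y (r a)) (y (r b))" using far by blast
        then show ?thesis by (intro exI[of _ "(a, b)"]) auto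
      qed
    qed
    then obtain s where s: "\<And>n. e \<le> dist (y (r (fst (s n)))) (y (r (snd (s n))))"
      "\<And>n. fst (s n) < fst (s (Suc n))" "\<And>n. snd (s n) < snd (s (Suc n))" by blast
    have "strict_mono (\<lambda>n. fst (s n))" "strict_mono (\<lambda>n. snd (s n))"
      using s by (simp_all add: strict_mono_Suc_iff)
    with C have "weakly_p_summable sX p (\<lambda>n. (x \<circ> r) (fst (s n)) - (x \<circ> r) (snd (s n)))"
      unfolding weakly_p_Cauchy_def by blast
    with pc have "(\<lambda>n. T ((x \<circ> r) (fst (s n)) - (x \<circ> r) (snd (s n)))) \<longlonglongrightarrow> 0"
      unfolding p_converging_def by blast
    then have "(\<lambda>n. dist (y (r (fst (s n)))) (y (r (snd (s n))))) \<longlonglongrightarrow> 0"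
      by (simp add: T.diff x(2) dist_norm tendsto_norm_zero_iff)
    then have "e \<le> 0" using s(1) by (intro LIMSEQ_le_const[of _ 0]) auto
    with e show False by simp
  qed
  then have "convergent (\<lambda>n. y (r n))" by (rule Cauchy_convergent)
  with r show "\<exists>r l. strict_mono (r :: nat \<Rightarrow> nat) \<and> (\<lambda>n. y (r n)) \<longlonglongrightarrow> l"
    unfolding convergent_def by blast
qed

lemma image_null_if_compact:
  assumes x: "weakly_p_summable sX p x" and "relatively_norm_compact (T ` range x)"
  shows "(\<lambda>n. T (x n)) \<longlonglongrightarrow> 0"
proof (rule Y.weakly_null_relatively_compact_imp_null)
  show "relatively_norm_compact (range (\<lambda>n. T (x n)))" using assms(2) by (simp add: image_image)
qed (rule Y.weakly_p_summable_tendsto_0[OF p weakly_p_summable_image[OF x]])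

end

section \<open>Operators on the sequence spaces\<close>

lemma relatively_weakly_p_compact_conj_space:
  "relatively_weakly_p_compact s p K \<longleftrightarrow> (\<exists>S. seq_operator (conj_space p) (conj_norm p) s S \<and>
     K \<subseteq> S ` {a \<in> conj_space p. conj_norm p a \<le> 1})"
  unfolding relatively_weakly_p_compact_def conj_space_def conj_norm_def Let_def by simp

context banach_over
begin

text \<open>
  The partial sums from \<open>m\<close> on are bounded by a multiple of the norm of the tail of \<open>a\<close>, which makes the
  series Cauchy even though it need not converge absolutely.
\<close>
lemma conj_space_combination_sums:
  assumes p: "p \<ge> 1" and x: "weakly_p_summable scale p x"
  obtains M where "\<And>a. a \<in> conj_space p \<Longrightarrow> summable (\<lambda>n. scale (a n) (x n))"
    and "\<And>a. a \<in> conj_space p \<Longrightarrow> norm (\<Sum>n. scale (a n) (x n)) \<le> M * conj_norm p a"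
proof -
  obtain M where M: "\<And>f N. f \<in> dual_ball scale \<Longrightarrow> (\<Sum>n<N. norm (f (x n)) powr p) \<le> M"
    using x unfolding weakly_p_summable_iff_bounded[OF p] by blast
  define B where "B = M powr (1 / p)"
  have le: "norm (\<Sum>n\<in>{m..<N}. scale (a n) (x n)) \<le> conj_norm p a * B" if a: "a \<in> conj_space p" for a m N
  proof (rule norm_combination_le[OF p a])
    fix f assume f: "f \<in> dual_ball scale"
    have "(\<Sum>n\<in>{m..<N}. norm (f (x n)) powr p) \<le> (\<Sum>n<N. norm (f (x n)) powr p)"
      by (intro sum_mono2) auto
    also have "\<dots> \<le> M" by (rule M[OF f])
    finally show "(\<Sum>n\<in>{m..<N}. norm (f (x n)) powr p) powr (1 / p) \<le> B"
      unfolding B_def using p by (intro powr_mono2) (auto intro: sum_nonneg)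
  qed simp
  have sm: "summable (\<lambda>n. scale (a n) (x n))" if a: "a \<in> conj_space p" for a
  proof (rule summable_Cauchy'[where g = "\<lambda>m. conj_norm p (seq_restrict {m..} a) * B"])
    have "norm (\<Sum>n\<in>{m..<N}. scale (a n) (x n)) \<le> conj_norm p (seq_restrict {m..} a) * B" for m N
      using le[OF seq_restrict_mem_conj_space[OF a, of "{m..}"], of m N] by (simp add: seq_restrict_def)
    then show "\<forall>\<^sub>F m in sequentially. \<forall>n\<ge>m. norm (\<Sum>n\<in>{m..<n}. scale (a n) (x n))
        \<le> conj_norm p (seq_restrict {m..} a) * B" by simp
    show "(\<lambda>m. conj_norm p (seq_restrict {m..} a) * B) \<longlonglongrightarrow> 0"
      using tendsto_mult_right[OF conj_norm_tail_tendsto_0[OF p a], of B] by simp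
  qed
  have "norm (\<Sum>n. scale (a n) (x n)) \<le> B * conj_norm p a" if a: "a \<in> conj_space p" for a
  proof (rule LIMSEQ_le_const2)
    show "(\<lambda>N. norm (\<Sum>n<N. scale (a n) (x n))) \<longlonglongrightarrow> norm (\<Sum>n. scale (a n) (x n))"
      by (intro tendsto_norm summable_LIMSEQ sm a)
    show "\<exists>N. \<forall>n\<ge>N. norm (\<Sum>n<n. scale (a n) (x n)) \<le> B * conj_norm p a"
      using le[OF a, of 0] by (auto simp: atLeast0LessThan mult.commute)
  qed
  with sm that show ?thesis by blast
qed

text \<open>
  The terms \<open>x\<^sub>n\<close> are the images of the unit vectors under \<open>a \<mapsto> \<Sum> a\<^sub>n x\<^sub>n\<close>.
\<close>
lemma range_weakly_p_compact:
  assumes p: "p \<ge> 1" and x: "weakly_p_summable scale p x"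
  shows "relatively_weakly_p_compact scale p (range x)"
proof -
  obtain M where sm: "\<And>a. a \<in> conj_space p \<Longrightarrow> summable (\<lambda>n. scale (a n) (x n))"
    and le: "\<And>a. a \<in> conj_space p \<Longrightarrow> norm (\<Sum>n. scale (a n) (x n)) \<le> M * conj_norm p a"
    using conj_space_combination_sums[OF p x] by blast
  define S where "S a = (\<Sum>n. scale (a n) (x n))" for a
  have bl: "bounded_linear (scale c)" for c
  proof (rule bounded_linear_intro[where K = "norm c"])
    show "scale c (r *\<^sub>R y) = r *\<^sub>R scale c y" for r y
      unfolding scale_of_real[symmetric] by (simp add: mult.commute)
  qed (simp_all add: scale_right_distrib norm_scale)
  have "seq_operator (conj_space p) (conj_norm p) scale S"
    unfolding seq_operator_def
  proof (intro conjI ballI allI exI[of _ M])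
    fix a b :: "nat \<Rightarrow> 'k" and c assume a: "a \<in> conj_space p" 
    show "S (\<lambda>n. a n + b n) = S a + S b" if "b \<in> conj_space p"
      unfolding S_def scale_left_distrib by (rule suminf_add[OF sm[OF a] sm[OF that], symmetric])
    show "S (\<lambda>n. c * a n) = scale c (S a)"
      using bounded_linear.suminf[OF bl sm[OF a], of c] by (simp add: S_def)
    show "norm (S a) \<le> M * conj_norm p a" unfolding S_def by (rule le[OF a])
  qed
  moreover have "range x \<subseteq> S ` {a \<in> conj_space p. conj_norm p a \<le> 1}"
  proof clarify
    fix n
    let ?e = "seq_restrict {n} (\<lambda>_. 1) :: nat \<Rightarrow> 'k"
    have "S ?e = (\<Sum>i\<in>{n}. scale (?e i) (x i))"
      unfolding S_def by (rule suminf_finite) (simp_all add: seq_restrict_def)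
    then have "x n = S ?e" by (simp add: seq_restrict_def)
    moreover have "?e \<in> {a \<in> conj_space p. conj_norm p a \<le> 1}"
      using seq_restrict_finite_mem_conj_space[of "{n}"] conj_norm_unit_vector[OF p] by blast
    ultimately show "x n \<in> S ` {a \<in> conj_space p. conj_norm p a \<le> 1}" by blast
  qed
  ultimately show ?thesis unfolding relatively_weakly_p_compact_conj_space by blast
qed

text \<open>
  Conversely, each operator on the sequence space is of this form. The images of the unit
  vectors are weakly \<open>p\<close>-summable because the \<open>l\<^sub>p\<close> norm of \<open>(f x\<^sub>n)\<^bsub>n<N\<^esub>\<close> is the value of \<open>f \<circ> S\<close> at
  a sequence in the unit ball; the expansion holds because finitely supported sequences are dense.
\<close>
lemma seq_operator_expansion:
  assumes p: "p \<ge> 1" and S: "seq_operator (conj_space p) (conj_norm p) scale S"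
  defines "x \<equiv> \<lambda>n. S (seq_restrict {n} (\<lambda>_. 1))"
  shows "weakly_p_summable scale p x"
    and "\<And>a. a \<in> conj_space p \<Longrightarrow> (\<lambda>n. scale (a n) (x n)) sums S a"
proof -
  have add: "\<And>a b. a \<in> conj_space p \<Longrightarrow> b \<in> conj_space p \<Longrightarrow> S (\<lambda>n. a n + b n) = S a + S b"
    and mult: "\<And>c a. a \<in> conj_space p \<Longrightarrow> S (\<lambda>n. c * a n) = scale c (S a)"
    using S by (simp_all add: seq_operator_def)
  obtain C where C: "\<And>a. a \<in> conj_space p \<Longrightarrow> norm (S a) \<le> C * conj_norm p a"
    using S unfolding seq_operator_def by blast
  have fin: "S (seq_restrict {..<N} a) = (\<Sum>n<N. scale (a n) (x n))" for a N
  proof (induction N)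
    case 0
    have "seq_restrict {..<0} a = (\<lambda>n. 0 * seq_restrict {0::nat} (\<lambda>_. 1) n)"
      by (simp add: seq_restrict_def)
    then show ?case by (simp only: mult seq_restrict_finite_mem_conj_space finite.intros) simp
  next
    case (Suc N)
    \<comment> \<open>The sequence \<open>seq_restrict {N} (\<lambda>_. 1)\<close> is the \<open>N\<close>-th unit vector.\<close>
    have eq: "seq_restrict {..<Suc N} a
        = (\<lambda>n. seq_restrict {..<N} a n + a N * seq_restrict {N} (\<lambda>_. 1) n)"
      by (auto simp: seq_restrict_def fun_eq_iff less_Suc_eq)
    have "(\<lambda>n. a N * seq_restrict {N} (\<lambda>_. 1) n) = seq_restrict {N} a"
      by (auto simp: seq_restrict_def fun_eq_iff)
    then have "(\<lambda>n. a N * seq_restrict {N} (\<lambda>_. 1) n) \<in> conj_space p"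
      by (simp add: seq_restrict_finite_mem_conj_space)
    then show ?case
      unfolding eq by (simp add: add mult seq_restrict_finite_mem_conj_space Suc x_def)
  qed
  show "weakly_p_summable scale p x"
    unfolding weakly_p_summable_iff_bounded[OF p]
  proof (intro exI ballI allI)
    fix f N assume f: "f \<in> dual_ball scale"
    let ?s = "(\<Sum>n<N. norm (f (x n)) powr p)"
    obtain a where a: "seq_restrict {..<N} a \<in> conj_space p" "conj_norm p (seq_restrict {..<N} a) \<le> 1"
      and sum: "(\<Sum>n<N. a n * f (x n)) = of_real (?s powr (1 / p))"
      using conj_norm_attained[OF p, of "{..<N}" "\<lambda>n. f (x n)"] by blast
    have "?s powr (1 / p) = norm (f (S (seq_restrict {..<N} a)))"
      by (simp add: fin dual_ball_sum[OF f] sum)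
    also have "\<dots> \<le> norm (S (seq_restrict {..<N} a))" by (rule dual_ball_le_norm[OF f])
    also have "\<dots> \<le> C * conj_norm p (seq_restrict {..<N} a)" by (rule C[OF a(1)])
    also have "\<dots> \<le> \<bar>C\<bar> * conj_norm p (seq_restrict {..<N} a)"
      by (intro mult_right_mono conj_norm_nonneg p a(1)) simp
    also have "\<dots> \<le> \<bar>C\<bar> * 1" by (intro mult_left_mono a(2)) simp
    finally have "(?s powr (1 / p)) powr p \<le> \<bar>C\<bar> powr p"
      using p by (intro powr_mono2) auto
    then show "?s \<le> \<bar>C\<bar> powr p" using p by (simp add: powr_powr sum_nonneg)
  qed
  show "(\<lambda>n. scale (a n) (x n)) sums S a" if a: "a \<in> conj_space p" for a
  proof -
    have split: "S a = (\<Sum>n<N. scale (a n) (x n)) + S (seq_restrict {N..} a)" for N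
    proof -
      have "S (\<lambda>n. seq_restrict {..<N} a n + seq_restrict {N..} a n)
          = S (seq_restrict {..<N} a) + S (seq_restrict {N..} a)"
        by (intro add seq_restrict_mem_conj_space a)
      moreover have "(\<lambda>n. seq_restrict {..<N} a n + seq_restrict {N..} a n) = a"
        by (auto simp: seq_restrict_def fun_eq_iff)
      ultimately show ?thesis by (simp add: fin)
    qed
    have "(\<lambda>N. S (seq_restrict {N..} a)) \<longlonglongrightarrow> 0"
    proof (rule Lim_null_comparison)
      show "\<forall>\<^sub>F N in sequentially. norm (S (seq_restrict {N..} a)) \<le> C * conj_norm p (seq_restrict {N..} a)"
        by (intro always_eventually allI C seq_restrict_mem_conj_space a)
      show "(\<lambda>N. C * conj_norm p (seq_restrict {N..} a)) \<longlonglongrightarrow> 0"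
        using tendsto_mult_left[OF conj_norm_tail_tendsto_0[OF p a], of C] by simp
    qed
    then have "(\<lambda>N. S a - S (seq_restrict {N..} a)) \<longlonglongrightarrow> S a - 0"
      by (intro tendsto_diff tendsto_const)
    moreover have "S a - S (seq_restrict {N..} a) = (\<Sum>n<N. scale (a n) (x n))" for N
      using split[of N] by simp
    ultimately show ?thesis by (simp add: sums_def)
  qed
qed

end

section \<open>The equivalences\<close>

text \<open>
  The index \<open>m\<close> is chosen so that all tails of \<open>(T x\<^sub>n)\<close> beyond \<open>m\<close> have weak \<open>l\<^sub>p\<close> norm at most \<open>e\<close>. Then
  \<open>T (S a)\<close> is within \<open>e\<close> of \<open>\<Sum>\<^bsub>n<m\<^esub> a\<^sub>n T x\<^sub>n\<close> for all \<open>a\<close> in the unit ball at once, and these finite sums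
  form a subset of a compact set.
\<close>
lemma (in banach_operator) compact_image_if_unconditionally:
  assumes uc: "unconditionally_p_converging sX sY p T" and K: "relatively_weakly_p_compact sX p K"
  shows "relatively_norm_compact (T ` K)"
proof (rule relatively_norm_compactI_approx)
  fix e :: real assume "e > 0"
  obtain S where S: "seq_operator (conj_space p) (conj_norm p) sX S"
    and KS: "K \<subseteq> S ` {a \<in> conj_space p. conj_norm p a \<le> 1}"
    using K unfolding relatively_weakly_p_compact_conj_space by blast
  define x where "x n = S (seq_restrict {n} (\<lambda>_. 1))" for n
  have x: "weakly_p_summable sX p x"
    and sums: "\<And>a. a \<in> conj_space p \<Longrightarrow> (\<lambda>n. sX (a n) (x n)) sums S a"
    unfolding x_def using X.seq_operator_expansion[OF p S] by blast+
  from uc x have "unconditionally_p_summable sY p (\<lambda>n. T (x n))"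
    by (simp add: unconditionally_p_converging_def)
  then obtain m where m: "\<And>f N. f \<in> dual_ball sY \<Longrightarrow>
      (\<Sum>n\<in>{m..<N}. norm (f (T (x n))) powr p) powr (1 / p) \<le> e"
    using \<open>e > 0\<close> unfolding Y.unconditionally_p_summable_iff_tails[OF p] by blast
  let ?Q = "{\<Sum>n<m. sY (a n) (T (x n)) | a. \<forall>n. norm (a n) \<le> 1}"
  have "\<exists>q\<in>?Q. dist y q \<le> e" if yK: "y \<in> T ` K" for y
  proof -
    obtain a where a: "a \<in> conj_space p" "conj_norm p a \<le> 1" and y: "y = T (S a)"
      using yK KS by blast
    have "norm (a n) \<le> 1" for n using norm_le_conj_norm[OF p a(1), of n] a(2) by simp
    then have "(\<Sum>n<m. sY (a n) (T (x n))) \<in> ?Q" by blast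
    moreover have "dist y (\<Sum>n<m. sY (a n) (T (x n))) \<le> e"
    proof (rule LIMSEQ_le_const2)
      have "(\<lambda>n. T (sX (a n) (x n))) sums T (S a)"
        by (rule bounded_linear.sums[OF bounded_linear_T sums[OF a(1)]])
      then have "(\<lambda>N. \<Sum>n<N. sY (a n) (T (x n))) \<longlonglongrightarrow> y" by (simp add: y T.scale sums_def)
      then show "(\<lambda>N. dist (\<Sum>n<N. sY (a n) (T (x n))) (\<Sum>n<m. sY (a n) (T (x n))))
          \<longlonglongrightarrow> dist y (\<Sum>n<m. sY (a n) (T (x n)))"
        by (intro tendsto_dist tendsto_const)
      have "dist (\<Sum>n<N. sY (a n) (T (x n))) (\<Sum>n<m. sY (a n) (T (x n))) \<le> e" if "N \<ge> m" for N
      proof -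
        have "(\<Sum>n<N. sY (a n) (T (x n))) - (\<Sum>n<m. sY (a n) (T (x n)))
            = (\<Sum>n\<in>{m..<N}. sY (a n) (T (x n)))"
          using sum_diff_nat_ivl[of 0 m N "\<lambda>n. sY (a n) (T (x n))"] that by (simp add: atLeast0LessThan)
        then have "dist (\<Sum>n<N. sY (a n) (T (x n))) (\<Sum>n<m. sY (a n) (T (x n)))
            = norm (\<Sum>n\<in>{m..<N}. sY (a n) (T (x n)))" by (simp add: dist_norm)
        also have "\<dots> \<le> conj_norm p a * e"
          by (rule Y.norm_combination_le[OF p a(1)]) (simp_all add: m)
        also have "\<dots> \<le> 1 * e" using a(2) \<open>e > 0\<close> by (intro mult_right_mono) auto
        finally show ?thesis by simp
      qed
      then show "\<exists>N. \<forall>n\<ge>N. dist (\<Sum>n<n. sY (a n) (T (x n))) (\<Sum>n<m. sY (a n) (T (x n))) \<le> e" by blast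
    qed
    ultimately show ?thesis by blast
  qed
  with Y.compact_combinations[of "\<lambda>n. T (x n)" m] show "\<exists>Q. compact Q \<and> (\<forall>y\<in>T ` K. \<exists>q\<in>Q. dist y q \<le> e)"
    by blast
qed

theorem theorem2p3:
  fixes sX :: "'k::real_or_complex \<Rightarrow> 'a::banach \<Rightarrow> 'a"
    and sY :: "'k \<Rightarrow> 'b::banach \<Rightarrow> 'b"
    and T :: "'a \<Rightarrow> 'b"
    and p :: real
  assumes "banach_over sX" and "banach_over sY"
    and "operator sX sY T"
    and "1 \<le> p"
  shows "(unconditionally_p_converging sX sY p T \<longleftrightarrow>
            (\<forall>K. relatively_weakly_p_precompact sX p K \<longrightarrow> relatively_norm_compact (T ` K))) \<and>
         (unconditionally_p_converging sX sY p T \<longleftrightarrow>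
            (\<forall>K. conditionally_weakly_p_compact sX p K \<longrightarrow> relatively_norm_compact (T ` K))) \<and>
         (unconditionally_p_converging sX sY p T \<longleftrightarrow>
            (\<forall>K. relatively_weakly_p_compact sX p K \<longrightarrow> relatively_norm_compact (T ` K)))"
proof -
  interpret banach_operator sX sY T p
    using assms by (simp add: banach_operator_def banach_operator_axioms_def)
  let ?U = "unconditionally_p_converging sX sY p T"
  let ?pre = "\<forall>K. relatively_weakly_p_precompact sX p K \<longrightarrow> relatively_norm_compact (T ` K)"
  let ?cond = "\<forall>K. conditionally_weakly_p_compact sX p K \<longrightarrow> relatively_norm_compact (T ` K)"
  let ?comp = "\<forall>K. relatively_weakly_p_compact sX p K \<longrightarrow> relatively_norm_compact (T ` K)"
  have "?U \<longleftrightarrow> p_converging"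
    using p_converging_if_unconditionally unconditionally_if_p_converging by blast
  moreover have "?cond" if p_converging
    using conditionally_compact_image[OF that] by blast
  moreover have "?pre" if "?cond"
    using that X.precompact_imp_conditionally_compact[OF p] by blast
  moreover have p_converging if "?pre"
    unfolding p_converging_def
    using that X.range_weakly_p_precompact[OF p] image_null_if_compact by blast
  moreover have "?comp" if "?U"
    using compact_image_if_unconditionally[OF that] by blast
  moreover have p_converging if "?comp"
    unfolding p_converging_def
    using that X.range_weakly_p_compact[OF p] image_null_if_compact by blast
  ultimately show ?thesis by argo
qed

end
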